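(* Assume that $\alpha=2$. For any $x_0\in\mathbb{R}$ the family of processes $(\mathcal{Z}^{(n)}:n\in\mathbb{N})$ possesses profile cut-off in the total variation distance as $n\to\infty$. The cut-off time is given by \[ t^{(n)}:=\frac{1}{2\lambda}\ln(\ln(n)) \] and the time window by \[ w^{(n)}:=\kappa+\mathrm{o}_n(1), \] where $\kappa$ is any positive constant and $\mathrm{o}_n(1)$ is any real sequence with $\lim_{n\to\infty}\mathrm{o}_n(1)=0$. Moreover, for any $b\in\mathbb{R}$ the limit \[ \lim_{n\to\infty}\mathrm{d}^{(n)}\big(t^{(n)}+bw^{(n)}\big)=\mathbf{d}_{\mathrm{TV}}\left(\left(\frac{2\lambda}{c}\right)^{1/2}e^{-\lambda\kappa b}x_0-e^{-2\lambda\kappa b}+\xi,\ \xi\right)=:G(b) \] exists, where the random variable $\xi$ has the Gumbel distribution, i.e. distribution function $F_\xi(x)=e^{-e^{-x}}$, $x\in\mathbb{R}$. In addition, $\lim_{b\to-\infty}G(b)=1$ and $\lim_{b\to\infty}G(b)=0$.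
   Context: Setting. Let $\lambda>0$, $c>0$, $\alpha\in(0,2]$, $x_0\in\mathbb{R}$ (deterministic). Let $L=(L_t:t\ge0)$ be a one-dimensional Lévy process with $\mathbb{E}[e^{izL_1}]=\exp(-c|z|^\alpha)$ for all $z\in\mathbb{R}$, and let $X=(X_t:t\ge0)$ be the unique strong solution (Ornstein–Uhlenbeck process) of \[ \mathrm{d}X_t=-\lambda X_t\,\mathrm{d}t+\mathrm{d}L_t\ (t\ge 0),\qquad X_0=x_0 . \] As $t\to\infty$, $X_t$ converges in distribution to a random variable $X_\infty$ having the law of $(1/(\lambda\alpha))^{1/\alpha}L_1$. Let $X^{(1)},X^{(2)},\ldots$ be i.i.d. copies of the process $X$ (same $x_0$), and let $X^{(1)}_\infty,X^{(2)}_\infty,\ldots$ be i.i.d. copies of $X_\infty$. For $n\in\mathbb{N}$ set $\mathcal{Z}^{(n)}_t=\max_{1\le j\le n}X^{(j)}_t$ for $t\ge0$, $\mathcal{Z}^{(n)}=(\mathcal{Z}^{(n)}_t:t\ge0)$, and let $\mathcal{Z}^{(n)}_\infty$ have the law of $\max_{1\le j\le n}X^{(j)}_\infty$. For real random variables $U,V$, $\mathbf{d}_{\mathrm{TV}}(U,V)=\sup_{F}|\mathbb{P}(U\in F)-\mathbb{P}(V\in F)|$ (supremum over Borel sets $F\subset\mathbb{R}$) is the total variation distance between their laws. Define $\mathrm{d}^{(n)}(t)=\mathbf{d}_{\mathrm{TV}}(\mathcal{Z}^{(n)}_t,\mathcal{Z}^{(n)}_\infty)$ for $t>0$. Definition (profile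 cut-off). The family $(\mathcal{Z}^{(n)}:n\in\mathbb{N})$ has profile cut-off at $((t^{(n)},w^{(n)}):n\in\mathbb{N})$ with cut-off time $t^{(n)}$, time window $w^{(n)}$ and profile function $G:\mathbb{R}\to[0,1]$ if $t^{(n)}\to\infty$ as $n\to\infty$, $\lim_{n\to\infty}w^{(n)}/t^{(n)}=0$, the limit $\lim_{n\to\infty}\mathrm{d}^{(n)}(t^{(n)}+bw^{(n)})=:G(b)$ exists for every $b\in\mathbb{R}$, $\lim_{b\to-\infty}G(b)=1$ and $\lim_{b\to\infty}G(b)=0$. (Here quantities are considered for $n$ large enough that they are defined.) *)

theory Defs
  imports "HOL-Probability.Probability"
begin

definition cadlag :: "(real \<Rightarrow> real) \<Rightarrow> bool" where
  "cadlag f \<longleftrightarrow>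
     (\<forall>t\<ge>0. (f \<longlongrightarrow> f t) (at_right t)) \<and>
     (\<forall>t>0. \<exists>l. (f \<longlongrightarrow> l) (at_left t))"

text \<open>
  Processes are indexed by real times, but only times \<open>t \<ge> 0\<close> are ever constrained.
  Stochastic continuity is not listed because it follows from right-continuity of the paths
  and stationarity of the increments.
\<close>

definition levy_process :: "'a measure \<Rightarrow> (real \<Rightarrow> 'a \<Rightarrow> real) \<Rightarrow> bool" where
  "levy_process M L \<longleftrightarrow>
     prob_space M \<and>
     (\<forall>t\<ge>0. L t \<in> borel_measurable M) \<and>
     (AE \<omega> in M. L 0 \<omega> = 0) \<and>
     (\<forall>(n::nat) \<tau>. 0 \<le> \<tau> 0 \<longrightarrow> (\<forall>i<n. \<tau> i < \<tau> (Suc i)) \<longrightarrow>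
        prob_space.indep_vars M (\<lambda>_. borel) (\<lambda>i \<omega>. L (\<tau> (Suc i)) \<omega> - L (\<tau> i) \<omega>) {..<n}) \<and>
     (\<forall>s\<ge>0. \<forall>h\<ge>0. distr M borel (\<lambda>\<omega>. L (s + h) \<omega> - L s \<omega>) = distr M borel (L h)) \<and>
     (AE \<omega> in M. cadlag (\<lambda>t. L t \<omega>))"

definition augmented_filtration :: "'a measure \<Rightarrow> (real \<Rightarrow> 'a \<Rightarrow> real) \<Rightarrow> real \<Rightarrow> 'a measure" where
  "augmented_filtration M L t =
     sigma (space M)
       ((\<Union>s\<in>{0..t}. {L s -` A \<inter> space M | A. A \<in> sets borel}) \<union> null_sets M)"

text \<open>
  Strong solution of \<open>dX = - lam X dt + dL\<close>, \<open>X 0 = x0\<close>. The noise is additive, so the equation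
  is the pathwise integral equation below, with no stochastic integral; cadlag paths are bounded
  on compact intervals, so the Lebesgue integral is a genuine one.
\<close>

definition OU_strong_solution ::
    "'a measure \<Rightarrow> (real \<Rightarrow> 'a \<Rightarrow> real) \<Rightarrow> real \<Rightarrow> real \<Rightarrow> (real \<Rightarrow> 'a \<Rightarrow> real) \<Rightarrow> bool" where
  "OU_strong_solution M L lam x0 X \<longleftrightarrow>
     (\<forall>t\<ge>0. X t \<in> borel_measurable (augmented_filtration M L t)) \<and>
     (AE \<omega> in M. cadlag (\<lambda>t. X t \<omega>)) \<and>
     (AE \<omega> in M. \<forall>t\<ge>0. X t \<omega> = x0 - lam * (LINT s:{0..t}|lborel. X s \<omega>) + L t \<omega>)"

text \<open>
  An i.i.d. sequence \<open>Y 1, Y 2, \<dots>\<close> of random elements of \<open>S\<close> with common law \<open>\<mu>\<close>;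
  the value \<open>Y 0\<close> is unused.
\<close>

definition iid_with_law :: "'b measure \<Rightarrow> 's measure \<Rightarrow> 's measure \<Rightarrow> (nat \<Rightarrow> 'b \<Rightarrow> 's) \<Rightarrow> bool" where
  "iid_with_law N S \<mu> Y \<longleftrightarrow>
     prob_space N \<and>
     prob_space.indep_vars N (\<lambda>_. S) Y {1..} \<and>
     (\<forall>j\<ge>1. distr N S (Y j) = \<mu>)"

abbreviation path_space :: "(real \<Rightarrow> real) measure" where
  "path_space \<equiv> (\<Pi>\<^sub>M t\<in>{0..}. (borel :: real measure))"

definition path :: "(real \<Rightarrow> 'a \<Rightarrow> real) \<Rightarrow> 'a \<Rightarrow> real \<Rightarrow> real" where
  "path X \<omega> = (\<lambda>t\<in>{0..}. X t \<omega>)"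

definition iid_process_copies ::
    "'a measure \<Rightarrow> (real \<Rightarrow> 'a \<Rightarrow> real) \<Rightarrow> 'b measure \<Rightarrow> (nat \<Rightarrow> real \<Rightarrow> 'b \<Rightarrow> real) \<Rightarrow> bool" where
  "iid_process_copies M X N Y \<longleftrightarrow>
     iid_with_law N path_space (distr M path_space (path X)) (\<lambda>j. path (Y j))"

text \<open>The two random variables may live on different probability spaces.\<close>

definition tv_dist :: "'a measure \<Rightarrow> ('a \<Rightarrow> real) \<Rightarrow> 'b measure \<Rightarrow> ('b \<Rightarrow> real) \<Rightarrow> real" where
  "tv_dist M U N V =
     (SUP F\<in>sets borel. \<bar>\<P>(\<omega> in M. U \<omega> \<in> F) - \<P>(\<omega> in N. V \<omega> \<in> F)\<bar>)"

definition profile_cutoff ::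
    "'a measure \<Rightarrow> (nat \<Rightarrow> real \<Rightarrow> 'a \<Rightarrow> real) \<Rightarrow> 'b measure \<Rightarrow> (nat \<Rightarrow> 'b \<Rightarrow> real)
      \<Rightarrow> (nat \<Rightarrow> real) \<Rightarrow> (nat \<Rightarrow> real) \<Rightarrow> (real \<Rightarrow> real) \<Rightarrow> bool" where
  "profile_cutoff N Z N' Zinf t w G \<longleftrightarrow>
     (\<forall>b. G b \<in> {0..1}) \<and>
     filterlim t at_top sequentially \<and>
     (\<lambda>n. w n / t n) \<longlonglongrightarrow> 0 \<and>
     (\<forall>b. (\<lambda>n. tv_dist N (Z n (t n + b * w n)) N' (Zinf n)) \<longlonglongrightarrow> G b) \<and>
     (G \<longlongrightarrow> 1) at_bot \<and>
     (G \<longlongrightarrow> 0) at_top"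

definition gumbel_distributed :: "'p measure \<Rightarrow> ('p \<Rightarrow> real) \<Rightarrow> bool" where
  "gumbel_distributed P \<xi> \<longleftrightarrow>
     prob_space P \<and> \<xi> \<in> borel_measurable P \<and>
     (\<forall>x. cdf (distr P borel \<xi>) x = exp (- exp (- x)))"

end

theory Submission
  imports Defs "HOL-Real_Asymp.Real_Asymp"
begin

text \<open>
  For \<open>\<alpha> = 2\<close> all laws are Gaussian. Put \<open>\<sigma>\<^sup>2 = c / \<lambda>\<close>, \<open>m = exp (- \<lambda> t) x0 / \<sigma>\<close> and
  \<open>r\<^sup>2 = 1 - exp (- 2 \<lambda> t)\<close>. Then \<open>X t / \<sigma>\<close> is normal with mean \<open>m\<close> and standard deviation \<open>r\<close>,
  and the limit variable divided by \<open>\<sigma>\<close> is standard normal, so the two maxima are maxima of \<open>n\<close>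
  independent normal variables that differ only in location and scale.

  Total variation does not change when the same invertible affine map is applied to both
  variables (\<open>tv_dist_affine\<close>). Take the map \<open>x \<mapsto> b (x / \<sigma> - b)\<close>, where
  \<open>b\<^sup>2 = 2 ln n - ln (4 \<pi> ln n)\<close> is the classical centering of Gaussian maxima. Under it the maximum
  of the limit variables converges to a Gumbel variable \<open>\<xi>\<close>, and the maximum at time \<open>t\<close> converges to
  \<open>\<xi> + s\<close> with \<open>s = lim (b m - (1 - r) b\<^sup>2)\<close>. At the time
  \<open>t = ln (ln n) / (2 \<lambda>) + \<beta> w\<close> one has \<open>exp (- \<lambda> t) \<approx> exp (- \<lambda> \<kappa> \<beta>) / sqrt (ln n)\<close>, while
  \<open>b \<approx> sqrt (2 ln n)\<close> and \<open>1 - r \<approx> exp (- 2 \<lambda> t) / 2\<close>. So both terms of \<open>s\<close> are of order one there, which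
  is why the cut-off happens on this scale, and their limits are the two terms of the shift in
  the profile function (\<open>cutoff_location\<close>).

  The distance is total variation, so convergence in distribution of the maxima would not suffice.
  Both maxima have explicit densities; these converge pointwise to the Gumbel density by the Mills
  ratio (\<open>gauss_max_limits\<close>), and Scheffe's lemma turns this into total variation convergence
  (\<open>gauss_max_tv_tendsto_gumbel\<close>). The triangle inequality (\<open>tendsto_tv_dist\<close>) then gives the limit.

  It remains to find the law of \<open>X t\<close>, which is given only as the solution of a pathwise integral
  equation driven by a Levy process whose law is known at time one. Multiplicativity in time,
  continuity in the frequency and right-continuity of the paths determine the characteristic
  function of \<open>L s\<close> (\<open>levy_gaussian_char\<close>). On each path, the implicit Euler scheme converges to
  the solution (\<open>implicit_euler_tendsto\<close>); the scheme is a weighted sum of independent increments, so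
  its characteristic function is a product, with an explicit limit (\<open>OU_gaussian_char\<close>).
\<close>

section \<open>Total variation distance\<close>

lemma abs_diff_le_1:
  fixes x y :: real
  assumes "0 \<le> x" "x \<le> 1" "0 \<le> y" "y \<le> 1"
  shows "\<bar>x - y\<bar> \<le> 1"
  using assms by linarith

lemma abs_diff_triangle_ineq': "\<bar>x - z\<bar> \<le> \<bar>x - y\<bar> + \<bar>y - z\<bar>" for x y z :: real
  by linarith

lemma tv_dist_bdd_above:
  assumes "prob_space M" "prob_space N"
  shows "bdd_above ((\<lambda>F. \<bar>\<P>(\<omega> in M. U \<omega> \<in> F) - \<P>(\<omega> in N. V \<omega> \<in> F)\<bar>) ` sets borel)"
proof -
  interpret M: prob_space M by fact
  interpret N: prob_space N by fact
  show ?thesis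
    using M.prob_le_1 N.prob_le_1 by (intro bdd_aboveI2[where M = 1] abs_diff_le_1) simp_all
qed

lemma tv_dist_upper:
  assumes "prob_space M" "prob_space N" "F \<in> sets borel"
  shows "\<bar>\<P>(\<omega> in M. U \<omega> \<in> F) - \<P>(\<omega> in N. V \<omega> \<in> F)\<bar> \<le> tv_dist M U N V"
  unfolding tv_dist_def by (rule cSUP_upper[OF assms(3) tv_dist_bdd_above[OF assms(1,2)]])

lemma tv_dist_least:
  assumes "\<And>F. F \<in> sets borel \<Longrightarrow> \<bar>\<P>(\<omega> in M. U \<omega> \<in> F) - \<P>(\<omega> in N. V \<omega> \<in> F)\<bar> \<le> B"
  shows "tv_dist M U N V \<le> B"
  unfolding tv_dist_def by (rule cSUP_least) (use assms in auto)

lemma tv_dist_nonneg: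
  assumes "prob_space M" "prob_space N"
  shows "0 \<le> tv_dist M U N V"
  using tv_dist_upper[OF assms, of "{}" U V] by simp

lemma tv_dist_le_1:
  assumes "prob_space M" "prob_space N"
  shows "tv_dist M U N V \<le> 1"
proof -
  interpret M: prob_space M by fact
  interpret N: prob_space N by fact
  show ?thesis
    using M.prob_le_1 N.prob_le_1 by (intro tv_dist_least abs_diff_le_1) simp_all
qed

lemma tv_dist_commute: "tv_dist M U N V = tv_dist N V M U"
  unfolding tv_dist_def by (simp add: abs_minus_commute)

lemma tv_dist_triangle:
  assumes "prob_space M" "prob_space N" "prob_space K"
  shows "tv_dist M U K W \<le> tv_dist M U N V + tv_dist N V K W"
proof (rule tv_dist_least)
  fix F :: "real set" assume "F \<in> sets borel"
  from tv_dist_upper[OF assms(1,2) this, of U V] tv_dist_upper[OF assms(2,3) this, of V W]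
  show "\<bar>\<P>(\<omega> in M. U \<omega> \<in> F) - \<P>(\<omega> in K. W \<omega> \<in> F)\<bar> \<le> tv_dist M U N V + tv_dist N V K W"
    by (rule order_trans[OF abs_diff_triangle_ineq' add_mono])
qed

lemma tv_dist_image_le:
  assumes "prob_space M" "prob_space N" and [measurable]: "g \<in> borel_measurable borel"
  shows "tv_dist M (\<lambda>\<omega>. g (U \<omega>)) N (\<lambda>\<omega>. g (V \<omega>)) \<le> tv_dist M U N V"
proof (rule tv_dist_least)
  fix F :: "real set" assume [measurable]: "F \<in> sets borel"
  have "g -` F \<in> sets borel"
    using measurable_sets_borel[OF assms(3)] by simp
  from tv_dist_upper[OF assms(1,2) this, of U V]
  show "\<bar>\<P>(\<omega> in M. g (U \<omega>) \<in> F) - \<P>(\<omega> in N. g (V \<omega>) \<in> F)\<bar> \<le> tv_dist M U N V"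
    by simp
qed

lemma tv_dist_affine:
  fixes a b :: real
  assumes "prob_space M" "prob_space N" "a \<noteq> 0"
  shows "tv_dist M (\<lambda>\<omega>. a * U \<omega> + b) N (\<lambda>\<omega>. a * V \<omega> + b) = tv_dist M U N V"
proof (rule antisym)
  show "tv_dist M (\<lambda>\<omega>. a * U \<omega> + b) N (\<lambda>\<omega>. a * V \<omega> + b) \<le> tv_dist M U N V"
    by (rule tv_dist_image_le[OF assms(1,2), of "\<lambda>x. a * x + b"]) simp
  show "tv_dist M U N V \<le> tv_dist M (\<lambda>\<omega>. a * U \<omega> + b) N (\<lambda>\<omega>. a * V \<omega> + b)"
    using tv_dist_image_le[OF assms(1,2), of "\<lambda>x. (x - b) / a" "\<lambda>\<omega>. a * U \<omega> + b" "\<lambda>\<omega>. a * V \<omega> + b"]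
      assms(3) by simp
qed

text \<open>
  Two applications of the triangle inequality in each direction bound the difference of the distances
  by the sum of the two errors.
\<close>

lemma tendsto_tv_dist:
  assumes M: "\<And>n. prob_space (M n)" and N: "\<And>n. prob_space (N n)" and "prob_space P" "prob_space Q"
    and U: "((\<lambda>n. tv_dist (M n) (U n) P \<xi>) \<longlongrightarrow> 0) F"
    and V: "((\<lambda>n. tv_dist (N n) (V n) Q \<eta>) \<longlongrightarrow> 0) F"
  shows "((\<lambda>n. tv_dist (M n) (U n) (N n) (V n)) \<longlongrightarrow> tv_dist P \<xi> Q \<eta>) F"
proof -
  have "norm (tv_dist (M n) (U n) (N n) (V n) - tv_dist P \<xi> Q \<eta>)
      \<le> tv_dist (M n) (U n) P \<xi> + tv_dist (N n) (V n) Q \<eta>" for n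
  proof -
    note P = M[of n] N[of n] assms(3,4)
    show ?thesis
      unfolding real_norm_def
    proof (rule abs_leI)
      show "tv_dist (M n) (U n) (N n) (V n) - tv_dist P \<xi> Q \<eta>
          \<le> tv_dist (M n) (U n) P \<xi> + tv_dist (N n) (V n) Q \<eta>"
        using tv_dist_triangle[OF P(1,3,2), of "U n" "V n" \<xi>] tv_dist_triangle[OF P(3,4,2), of \<xi> "V n" \<eta>]
        unfolding tv_dist_commute[of Q \<eta> "N n" "V n"] by linarith
      show "- (tv_dist (M n) (U n) (N n) (V n) - tv_dist P \<xi> Q \<eta>)
          \<le> tv_dist (M n) (U n) P \<xi> + tv_dist (N n) (V n) Q \<eta>"
        using tv_dist_triangle[OF P(3,1,4), of \<xi> \<eta> "U n"] tv_dist_triangle[OF P(1,2,4), of "U n" \<eta> "V n"]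
        unfolding tv_dist_commute[of P \<xi> "M n" "U n"] by linarith
    qed
  qed
  then have le: "\<forall>\<^sub>F n in F. norm (tv_dist (M n) (U n) (N n) (V n) - tv_dist P \<xi> Q \<eta>)
      \<le> tv_dist (M n) (U n) P \<xi> + tv_dist (N n) (V n) Q \<eta>"
    by (rule eventuallyI)
  have lim: "((\<lambda>n. tv_dist (M n) (U n) P \<xi> + tv_dist (N n) (V n) Q \<eta>) \<longlongrightarrow> 0) F"
    using tendsto_add[OF U V] by simp
  show ?thesis
    by (rule LIM_zero_cancel) (rule Lim_null_comparison[OF le lim])
qed

lemma integral_indicator_comp:
  assumes [measurable]: "U \<in> borel_measurable M" "F \<in> sets borel"
  shows "(\<integral>\<omega>. indicator F (U \<omega>) \<partial>M) = \<P>(\<omega> in M. U \<omega> \<in> F)"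
proof -
  have "(\<integral>\<omega>. indicator F (U \<omega>) \<partial>M) = (\<integral>\<omega>. indicator {\<omega> \<in> space M. U \<omega> \<in> F} \<omega> \<partial>M)"
    by (rule Bochner_Integration.integral_cong) (auto split: split_indicator)
  also have "\<dots> = \<P>(\<omega> in M. U \<omega> \<in> F)"
    by (simp add: Int_absorb2 Collect_mono)
  finally show ?thesis .
qed

text \<open>
  On each Borel set the two probabilities differ by the integral of \<open>f - g\<close> over that set.
\<close>

lemma tv_dist_le_nn_integral_density:
  fixes f g :: "real \<Rightarrow> real"
  assumes M: "prob_space M" and N: "prob_space N"
    and U: "distributed M lborel U (\<lambda>x. ennreal (f x))" and V: "distributed N lborel V (\<lambda>x. ennreal (g x))"
    and f0: "\<And>x. 0 \<le> f x" and g0: "\<And>x. 0 \<le> g x"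
  shows "ennreal (tv_dist M U N V) \<le> (\<integral>\<^sup>+x. ennreal (norm (f x - g x)) \<partial>lborel)"
proof -
  interpret M: prob_space M by fact
  interpret N: prob_space N by fact
  have fm [measurable]: "f \<in> borel_measurable borel" and gm [measurable]: "g \<in> borel_measurable borel"
    using distributed_real_measurable[OF _ U] distributed_real_measurable[OF _ V] f0 g0 by auto
  have fi: "integrable lborel f" and gi: "integrable lborel g"
    using distributed_integrable[OF U, of "\<lambda>_. 1"] distributed_integrable[OF V, of "\<lambda>_. 1"] f0 g0
    by auto
  have di: "integrable lborel (\<lambda>x. norm (f x - g x))"
    using fi gi by simp
  have "tv_dist M U N V \<le> (\<integral>x. norm (f x - g x) \<partial>lborel)"
  proof (rule tv_dist_least)
    fix F :: "real set" assume F [measurable]: "F \<in> sets borel"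
    have "\<P>(\<omega> in M. U \<omega> \<in> F) = (\<integral>x. f x * indicator F x \<partial>lborel)"
      using distributed_integral[OF U, of "indicator F"] f0 distributed_measurable[OF U]
      by (simp add: integral_indicator_comp)
    moreover have "\<P>(\<omega> in N. V \<omega> \<in> F) = (\<integral>x. g x * indicator F x \<partial>lborel)"
      using distributed_integral[OF V, of "indicator F"] g0 distributed_measurable[OF V]
      by (simp add: integral_indicator_comp)
    moreover have fF: "integrable lborel (\<lambda>x. f x * indicator F x)"
      and gF: "integrable lborel (\<lambda>x. g x * indicator F x)"
      using fi gi by (simp_all add: integrable_real_mult_indicator)
    ultimately have "\<P>(\<omega> in M. U \<omega> \<in> F) - \<P>(\<omega> in N. V \<omega> \<in> F)
        = (\<integral>x. f x * indicator F x - g x * indicator F x \<partial>lborel)"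
      using Bochner_Integration.integral_diff[OF fF gF] by simp
    also have "\<bar>\<dots>\<bar> \<le> (\<integral>x. norm (f x * indicator F x - g x * indicator F x) \<partial>lborel)"
      using integral_norm_bound[of lborel "\<lambda>x. f x * indicator F x - g x * indicator F x"] by simp
    also have "\<dots> \<le> (\<integral>x. norm (f x - g x) \<partial>lborel)"
    proof (rule integral_mono)
      show "integrable lborel (\<lambda>x. norm (f x * indicator F x - g x * indicator F x))"
        using fF gF by (intro integrable_norm Bochner_Integration.integrable_diff)
    qed (use di in \<open>auto split: split_indicator\<close>)
    finally show "\<bar>\<P>(\<omega> in M. U \<omega> \<in> F) - \<P>(\<omega> in N. V \<omega> \<in> F)\<bar> \<le> (\<integral>x. norm (f x - g x) \<partial>lborel)" .
  qed
  then have "ennreal (tv_dist M U N V) \<le> ennreal (\<integral>x. norm (f x - g x) \<partial>lborel)"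
    by (rule ennreal_leI)
  also have "\<dots> = (\<integral>\<^sup>+x. ennreal (norm (f x - g x)) \<partial>lborel)"
    using di by (subst nn_integral_eq_integral) auto
  finally show ?thesis .
qed

text \<open>
  All the densities have mass one, so Scheffe's lemma upgrades their pointwise convergence to
  convergence in \<open>L\<^sup>1\<close>, which dominates total variation. The densities are required only
  eventually, because the normalising constants of extreme value theory make sense only for large \<open>n\<close>.
\<close>

lemma tv_dist_tendsto_0_of_densities:
  fixes f :: "nat \<Rightarrow> real \<Rightarrow> real" and g :: "real \<Rightarrow> real"
  assumes M: "\<And>n. prob_space (M n)" and N: "prob_space N"
    and U: "eventually (\<lambda>n. distributed (M n) lborel (U n) (\<lambda>x. ennreal (f n x))) sequentially"
    and V: "distributed N lborel V (\<lambda>x. ennreal (g x))"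
    and f0: "eventually (\<lambda>n. \<forall>x. 0 \<le> f n x) sequentially" and g0: "\<And>x. 0 \<le> g x"
    and lim: "\<And>x. (\<lambda>n. f n x) \<longlonglongrightarrow> g x"
  shows "(\<lambda>n. tv_dist (M n) (U n) N V) \<longlonglongrightarrow> 0"
proof -
  interpret N: prob_space N by fact
  obtain n0 where n0: "\<And>n. n \<ge> n0 \<Longrightarrow> distributed (M n) lborel (U n) (\<lambda>x. ennreal (f n x))"
     "\<And>n x. n \<ge> n0 \<Longrightarrow> 0 \<le> f n x"
    using eventually_conj[OF U f0] by (auto simp: eventually_sequentially)
  have fm: "f n \<in> borel_measurable borel" if "n \<ge> n0" for n
    using distributed_real_measurable[OF _ n0(1)] that n0(2) by auto
  have gm: "g \<in> borel_measurable borel"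
    using distributed_real_measurable[OF _ V] g0 by auto
  have mass: "(\<integral>\<^sup>+x. ennreal (f n x) \<partial>lborel) = 1" if "n \<ge> n0" for n
    using distributed_nn_integral[OF n0(1)[OF that], of "\<lambda>_. 1"] prob_space.emeasure_space_1[OF M] by simp
  have mass_g: "(\<integral>\<^sup>+x. ennreal (g x) \<partial>lborel) = 1"
    using distributed_nn_integral[OF V, of "\<lambda>_. 1"] N.emeasure_space_1 by simp
  have gi: "integrable lborel g"
    using mass_g gm g0 by (intro integrableI_nonneg) auto
  have "(\<lambda>n. \<integral>\<^sup>+x. ennreal (norm (f (n + n0) x - g x)) \<partial>lborel) \<longlonglongrightarrow> 0"
  proof (rule Scheffe_lemma2)
    show "AE x in lborel. (\<lambda>n. f (n + n0) x) \<longlonglongrightarrow> g x"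
      using LIMSEQ_ignore_initial_segment[OF lim] by simp
  qed (use fm mass mass_g n0 g0 gi in simp_all)
  then have "(\<lambda>n. ennreal (tv_dist (M (n + n0)) (U (n + n0)) N V)) \<longlonglongrightarrow> ennreal 0"
    unfolding ennreal_0
  proof (rule tendsto_sandwich[OF _ _ tendsto_const, rotated -1])
    show "\<forall>\<^sub>F n in sequentially. ennreal (tv_dist (M (n + n0)) (U (n + n0)) N V)
        \<le> (\<integral>\<^sup>+x. ennreal (norm (f (n + n0) x - g x)) \<partial>lborel)"
      by (intro always_eventually allI tv_dist_le_nn_integral_density[OF M N n0(1) V]) (simp_all add: n0(2) g0)
  qed simp
  then have "(\<lambda>n. tv_dist (M (n + n0)) (U (n + n0)) N V) \<longlonglongrightarrow> 0"
    by (subst (asm) tendsto_ennreal_iff) (auto intro!: always_eventually tv_dist_nonneg M N)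
  then show ?thesis
    by (rule LIMSEQ_offset)
qed

text \<open>
  The fundamental theorem of calculus identifies the two measures on half-open intervals, which
  generate the Borel sets.
\<close>

lemma distributed_if_cdf_has_derivative:
  assumes "prob_space M" and U [measurable]: "U \<in> borel_measurable M"
    and cdf: "\<And>x. \<P>(\<omega> in M. U \<omega> \<le> x) = F x"
    and D: "\<And>x. (F has_real_derivative f x) (at x)"
    and f: "continuous_on UNIV f" and f0: "\<And>x. 0 \<le> f x"
  shows "distributed M lborel U (\<lambda>x. ennreal (f x))"
proof -
  interpret prob_space M by fact
  have [measurable]: "f \<in> borel_measurable borel"
    using f by (rule borel_measurable_continuous_onI)
  interpret D: real_distribution "distr M borel U" by simp
  have cdf': "cdf (distr M borel U) x = F x" for x
    by (simp add: cdf_def2 measure_distr cdf[symmetric] vimage_def Int_def conj_commute)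
  have "distr M borel U = density lborel f"
  proof (rule measure_eqI_generator_eq[where \<Omega> = UNIV and A = "\<lambda>i::nat. {- real i <.. real i}"])
    fix X assume "X \<in> range (\<lambda>(a, b). {a<..b::real})"
    then obtain a b where X: "X = {a<..b}" by auto
    show "emeasure (distr M borel U) X = emeasure (density lborel f) X"
    proof (cases "a \<le> b")
      case True
      have "emeasure (density lborel f) X = (\<integral>\<^sup>+x. ennreal (f x) * indicator {a<..b} x \<partial>lborel)"
        unfolding X by (subst emeasure_density) auto
      also have "\<dots> = (\<integral>\<^sup>+x. ennreal (f x) * indicator {a..b} x \<partial>lborel)"
        by (rule nn_integral_cong_AE) (use AE_lborel_singleton[of a] in \<open>auto split: split_indicator\<close>)
      also have "\<dots> = ennreal (F b - F a)"
        by (rule nn_integral_FTC_Icc) (use True D f0 in auto)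
      also have "\<dots> = emeasure (distr M borel U) X"
        using True unfolding X by (simp add: D.emeasure_Ioc cdf')
      finally show ?thesis ..
    qed (simp add: X)
  next
    show "range (\<lambda>i::nat. {- real i <.. real i}) \<subseteq> range (\<lambda>(a, b). {a<..b::real})" by auto
    show "emeasure (distr M borel U) {- real i<..real i} \<noteq> \<infinity>" for i
      by (simp add: D.emeasure_eq_measure)
  qed (auto simp: UN_Ioc_eq_UNIV Int_stable_def borel_sigma_sets_Ioc)
  then show ?thesis
    unfolding distributed_def by (auto simp: distr_def)
qed

section \<open>The standard normal tail\<close>

abbreviation std_normal_cdf :: "real \<Rightarrow> real" ("\<Phi>")
  where "\<Phi> \<equiv> cdf std_normal_distribution"

lemma std_normal_density_eq: "std_normal_density x = exp (- (x\<^sup>2 / 2)) / sqrt (2 * pi)"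
  by (simp add: std_normal_density_def)

lemma std_normal_density_pos: "0 < std_normal_density x"
  by (simp add: normal_density_pos)

lemma DERIV_std_normal_density [derivative_intros]:
  assumes "(f has_real_derivative f') (at x)"
  shows "((\<lambda>x. std_normal_density (f x)) has_real_derivative - f x * std_normal_density (f x) * f') (at x)"
proof -
  have "((\<lambda>x. exp (- ((f x)\<^sup>2 / 2))) has_real_derivative exp (- ((f x)\<^sup>2 / 2)) * (- (f x * f'))) (at x)"
    by (rule derivative_eq_intros refl assms | simp)+
  from DERIV_cdivide[OF this, of "sqrt (2 * pi)"] show ?thesis
    unfolding std_normal_density_eq by (simp add: mult_ac)
qed

lemma std_normal_cdf_diff:
  assumes "a \<le> y"
  shows "\<Phi> y - \<Phi> a = integral {a..y} std_normal_density"
proof (cases "a = y")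
  case False
  interpret real_distribution std_normal_distribution
    by (rule real_dist_normal_dist)
  have "\<Phi> y - \<Phi> a = measure std_normal_distribution {a<..y}"
    using assms False by (intro cdf_diff_eq) simp
  also have "\<dots> = (\<integral>x. indicator {a<..y} x \<partial>std_normal_distribution)"
    by simp
  also have "\<dots> = (\<integral>x. std_normal_density x * indicator {a<..y} x \<partial>lborel)"
    by (rule integral_real_density) auto
  also have "\<dots> = (\<integral>x. std_normal_density x * indicator {a..y} x \<partial>lborel)"
    by (rule integral_cong_AE) (use AE_lborel_singleton[of a] in \<open>auto split: split_indicator\<close>)
  also have "\<dots> = (LINT x:{a..y}|lborel. std_normal_density x)"
    by (simp add: set_lebesgue_integral_def mult.commute)
  also have "\<dots> = integral {a..y} std_normal_density"
    by (rule set_borel_integral_eq_integral)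
       (auto simp: set_integrable_def mult.commute intro!: integrable_real_mult_indicator)
  finally show ?thesis .
qed simp

lemma DERIV_std_normal_cdf [derivative_intros]:
  assumes "(f has_real_derivative f') (at x)"
  shows "((\<lambda>x. \<Phi> (f x)) has_real_derivative std_normal_density (f x) * f') (at x)"
proof -
  have "(\<Phi> has_real_derivative std_normal_density y) (at y)" for y
  proof -
    have "((\<lambda>z. integral {y - 1..z} std_normal_density) has_real_derivative std_normal_density y)
        (at y within {y - 1..y + 1})"
      by (rule integral_has_real_derivative)
         (auto simp: std_normal_density_eq intro!: continuous_intros)
    then have "((\<lambda>z. integral {y - 1..z} std_normal_density) has_real_derivative std_normal_density y) (at y)"
      by (subst (asm) at_within_interior) auto
    then have "((\<lambda>z. \<Phi> (y - 1) + integral {y - 1..z} std_normal_density)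
        has_real_derivative std_normal_density y) (at y)"
      by (auto intro!: derivative_eq_intros)
    then show ?thesis
    proof (rule has_field_derivative_transform_within_open[of _ _ _ "{y - 1<..}"])
      show "\<Phi> (y - 1) + integral {y - 1..z} std_normal_density = \<Phi> z" if "z \<in> {y - 1<..}" for z
        using std_normal_cdf_diff[of "y - 1" z] that by simp
    qed auto
  qed
  from DERIV_chain2[OF this assms] show ?thesis .
qed

lemma std_normal_cdf_at_top: "(\<Phi> \<longlongrightarrow> 1) at_top"
  using real_distribution.cdf_lim_at_top_prob[OF real_dist_normal_dist] .

lemma std_normal_cdf_bounds: "0 \<le> \<Phi> x" "\<Phi> x \<le> 1"
  using real_distribution.cdf_bounded_prob[OF real_dist_normal_dist]
  by (auto simp: cdf_def)

text \<open>
  A strictly decreasing function with limit \<open>0\<close> at infinity is positive; the difference of the two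
  sides is one. The same argument gives the lower bound.
\<close>

lemma mills_upper:
  assumes "x > 0"
  shows "1 - \<Phi> x < std_normal_density x / x"
proof -
  have "0 < std_normal_density x / x - (1 - \<Phi> x)"
  proof (rule DERIV_neg_imp_decreasing_at_top[of x])
    fix y assume "x \<le> y"
    with assms have y: "y > 0" by simp
    have "((\<lambda>x. std_normal_density x / x - (1 - \<Phi> x)) has_real_derivative - std_normal_density y / y\<^sup>2) (at y)"
      by (rule derivative_eq_intros refl | use y in \<open>simp add: power2_eq_square field_simps\<close>)+
    then show "\<exists>D. ((\<lambda>x. std_normal_density x / x - (1 - \<Phi> x)) has_real_derivative D) (at y) \<and> D < 0"
      using y std_normal_density_pos[of y] by (intro exI conjI) auto
  next
    have "((\<lambda>x::real. std_normal_density x / x) \<longlongrightarrow> 0) at_top"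
      unfolding std_normal_density_eq by real_asymp
    from tendsto_diff[OF this tendsto_diff[OF tendsto_const[of 1] std_normal_cdf_at_top]]
    show "((\<lambda>x. std_normal_density x / x - (1 - \<Phi> x)) \<longlongrightarrow> 0) at_top" by simp
  qed
  then show ?thesis by simp
qed

lemma mills_lower: "std_normal_density x * (x / (1 + x\<^sup>2)) < 1 - \<Phi> x"
proof -
  have "0 < (1 - \<Phi> x) - std_normal_density x * (x / (1 + x\<^sup>2))"
  proof (rule DERIV_neg_imp_decreasing_at_top[of x])
    fix y :: real
    have pos: "1 + y\<^sup>2 > 0" by (rule add_pos_nonneg) auto
    have q: "((\<lambda>x. x / (1 + x\<^sup>2)) has_real_derivative (1 - y\<^sup>2) / (1 + y\<^sup>2)\<^sup>2) (at y)"
      by (rule derivative_eq_intros refl | use pos in \<open>simp add: power2_eq_square\<close>)+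
    have D: "((\<lambda>x. (1 - \<Phi> x) - std_normal_density x * (x / (1 + x\<^sup>2))) has_real_derivative
        - std_normal_density y - (- y * std_normal_density y * (y / (1 + y\<^sup>2))
           + (1 - y\<^sup>2) / (1 + y\<^sup>2)\<^sup>2 * std_normal_density y)) (at y)"
      by (rule derivative_eq_intros q refl | simp)+
    have eq: "- std_normal_density y - (- y * std_normal_density y * (y / (1 + y\<^sup>2))
           + (1 - y\<^sup>2) / (1 + y\<^sup>2)\<^sup>2 * std_normal_density y) = - 2 * std_normal_density y / (1 + y\<^sup>2)\<^sup>2"
    proof -
      define d where "d = 1 + y\<^sup>2"
      have y2: "y\<^sup>2 = d - 1" and d: "d \<noteq> 0" using pos by (simp_all add: d_def)
      have "- std_normal_density y - (- y * std_normal_density y * (y / d) + (1 - y\<^sup>2) / d\<^sup>2 * std_normal_density y)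
          = std_normal_density y * (y\<^sup>2 / d - 1 - (1 - y\<^sup>2) / d\<^sup>2)"
        by (simp add: algebra_simps power2_eq_square)
      also have "y\<^sup>2 / d - 1 - (1 - y\<^sup>2) / d\<^sup>2 = - 2 / d\<^sup>2"
        unfolding y2 using d by (simp add: diff_divide_distrib power2_eq_square)
      also have "std_normal_density y * (- 2 / d\<^sup>2) = - 2 * std_normal_density y / d\<^sup>2"
        by simp
      finally show ?thesis by (simp add: d_def)
    qed
    have neg: "- 2 * std_normal_density y / (1 + y\<^sup>2)\<^sup>2 < 0"
      using pos std_normal_density_pos[of y] by (intro divide_neg_pos) auto
    show "\<exists>D. ((\<lambda>x. (1 - \<Phi> x) - std_normal_density x * (x / (1 + x\<^sup>2)))
        has_real_derivative D) (at y) \<and> D < 0"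
      by (rule exI, rule conjI, rule D[unfolded eq], rule neg)
  next
    have "((\<lambda>x::real. std_normal_density x * (x / (1 + x\<^sup>2))) \<longlongrightarrow> 0) at_top"
      unfolding std_normal_density_eq by real_asymp
    from tendsto_diff[OF tendsto_diff[OF tendsto_const[of 1] std_normal_cdf_at_top] this]
    show "((\<lambda>x. (1 - \<Phi> x) - std_normal_density x * (x / (1 + x\<^sup>2))) \<longlongrightarrow> 0) at_top" by simp
  qed
  then show ?thesis by simp
qed

lemma mills_ratio: "((\<lambda>x. (1 - \<Phi> x) * x / std_normal_density x) \<longlongrightarrow> 1) at_top"
proof -
  have lower: "\<forall>\<^sub>F x in at_top. x\<^sup>2 / (1 + x\<^sup>2) \<le> (1 - \<Phi> x) * x / std_normal_density x"
    using eventually_gt_at_top[of 0]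
  proof eventually_elim
    case (elim x)
    have "x\<^sup>2 / (1 + x\<^sup>2) * std_normal_density x = std_normal_density x * (x / (1 + x\<^sup>2)) * x"
      by (simp add: power2_eq_square)
    also have "\<dots> \<le> (1 - \<Phi> x) * x"
      using mills_lower[of x] elim by (intro mult_right_mono) auto
    finally show ?case
      unfolding pos_le_divide_eq[OF std_normal_density_pos] .
  qed
  have upper: "\<forall>\<^sub>F x in at_top. (1 - \<Phi> x) * x / std_normal_density x \<le> 1"
    using eventually_gt_at_top[of 0]
  proof eventually_elim
    case (elim x)
    then have "(1 - \<Phi> x) * x \<le> std_normal_density x"
      using mills_upper[of x] by (simp add: pos_less_divide_eq)
    then show ?case
      unfolding pos_divide_le_eq[OF std_normal_density_pos] by simp
  qed
  have lim: "((\<lambda>x::real. x\<^sup>2 / (1 + x\<^sup>2)) \<longlongrightarrow> 1) at_top"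
    by real_asymp
  show ?thesis
    by (rule tendsto_sandwich[OF lower upper lim tendsto_const])
qed

section \<open>Gaussian maxima and the Gumbel law\<close>

text \<open>
  The centering \<open>b\<close> has to satisfy \<open>b \<longlongrightarrow> \<infinity>\<close> and \<open>n \<phi>(b) / b \<longlongrightarrow> 1\<close> for the standard normal density
  \<open>\<phi>\<close>; this is an explicit asymptotic solution. The radicand may be negative for small \<open>n\<close>, so its
  properties hold only eventually.
\<close>

definition gauss_max_center :: "nat \<Rightarrow> real" where
  "gauss_max_center n = sqrt (2 * ln (real n) - ln (4 * pi * ln (real n)))"

lemma gauss_max_center_at_top: "filterlim gauss_max_center at_top sequentially"
  unfolding gauss_max_center_def by real_asymp

lemma gauss_max_center_sq:
  "\<forall>\<^sub>F n in sequentially. (gauss_max_center n)\<^sup>2 = 2 * ln (real n) - ln (4 * pi * ln (real n))"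
proof -
  have "filterlim (\<lambda>n. 2 * ln (real n) - ln (4 * pi * ln (real n))) at_top sequentially"
    by real_asymp
  then have "\<forall>\<^sub>F n in sequentially. 0 \<le> 2 * ln (real n) - ln (4 * pi * ln (real n))"
    unfolding filterlim_at_top by (rule spec)
  then show ?thesis
    by eventually_elim (simp add: gauss_max_center_def)
qed

lemma gauss_max_center_density:
  "(\<lambda>n. real n * std_normal_density (gauss_max_center n) / gauss_max_center n) \<longlonglongrightarrow> 1"
proof -
  define q where "q n = 2 * ln (real n) - ln (4 * pi * ln (real n))" for n
  have "(\<lambda>n. 2 * ln (real n) / q n) \<longlonglongrightarrow> 1"
    unfolding q_def by real_asymp
  from tendsto_real_sqrt[OF this] have "(\<lambda>n. sqrt (2 * ln (real n) / q n)) \<longlonglongrightarrow> 1" by simp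
  then show ?thesis
  proof (rule Lim_transform_eventually)
    show "\<forall>\<^sub>F n in sequentially. sqrt (2 * ln (real n) / q n)
        = real n * std_normal_density (gauss_max_center n) / gauss_max_center n"
      using gauss_max_center_sq eventually_gt_at_top[of 1]
    proof eventually_elim
      case (elim n)
      then have L: "0 < ln (real n)" by simp
      have "exp (- ((gauss_max_center n)\<^sup>2 / 2)) = exp (ln (4 * pi * ln (real n)) / 2 - ln (real n))"
        unfolding elim(1) by (simp add: diff_divide_distrib)
      also have "\<dots> = sqrt (4 * pi * ln (real n)) / real n"
      proof -
        have "ln (4 * pi * ln (real n)) / 2 = ln (sqrt (4 * pi * ln (real n)))"
          using L by (subst ln_sqrt) simp_all
        then show ?thesis
          using L elim(2) by (simp only: exp_diff) simp
      qed
      finally have "real n * std_normal_density (gauss_max_center n)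
          = sqrt (4 * pi * ln (real n)) / sqrt (2 * pi)"
        using elim(2) by (simp add: std_normal_density_eq)
      also have "\<dots> = sqrt (2 * ln (real n))"
      proof -
        have "sqrt (4 * pi * ln (real n)) = sqrt (2 * ln (real n)) * sqrt (2 * pi)"
          unfolding real_sqrt_mult[symmetric] by (rule arg_cong[where f = sqrt]) simp
        then show ?thesis by simp
      qed
      finally show ?case
        unfolding gauss_max_center_def q_def by (simp only: real_sqrt_divide)
    qed
  qed
qed

text \<open>
  Write \<open>\<phi>\<close> for the density. Since \<open>v\<^sup>2 - b\<^sup>2 = 2 b (v - b) + (v - b)\<^sup>2\<close> and \<open>v - b\<close> vanishes, the quotient
  \<open>\<phi>(v) / \<phi>(b)\<close> tends to \<open>exp (- y)\<close>. By the Mills ratio \<open>n (1 - \<Phi>(v))\<close> has the same limit, and the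
  power of \<open>\<Phi>(v)\<close> follows by comparison with \<open>(1 - exp (- y) / n) ^ n\<close>. The point \<open>v\<close> is allowed to
  depend on \<open>n\<close> so that a varying mean and variance can be absorbed into it.
\<close>

lemma gauss_max_limits:
  fixes b v :: "nat \<Rightarrow> real"
  assumes b: "filterlim b at_top sequentially"
    and dens: "(\<lambda>n. real n * std_normal_density (b n) / b n) \<longlonglongrightarrow> 1"
    and v: "(\<lambda>n. b n * (v n - b n)) \<longlonglongrightarrow> y"
  shows "(\<lambda>n. real n * std_normal_density (v n) / b n) \<longlonglongrightarrow> exp (- y)"
    and "(\<lambda>n. \<Phi> (v n) ^ (n - 1)) \<longlonglongrightarrow> exp (- exp (- y))"
proof -
  have b_pos: "\<forall>\<^sub>F n in sequentially. 0 < b n"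
    using b by (simp add: filterlim_at_top_dense)
  have inv_b: "(\<lambda>n. 1 / b n) \<longlonglongrightarrow> 0"
    by (rule tendsto_divide_0[OF tendsto_const filterlim_at_top_imp_at_infinity[OF b]])
  have diff: "(\<lambda>n. v n - b n) \<longlonglongrightarrow> 0"
    by (rule Lim_transform_eventually[OF tendsto_mult[OF v inv_b, simplified]])
      (use b_pos in eventually_elim, simp)
  have ratio: "(\<lambda>n. b n / v n) \<longlonglongrightarrow> 1"
  proof -
    have "(\<lambda>n. 1 / (1 + (v n - b n) * (1 / b n))) \<longlonglongrightarrow> 1 / (1 + 0 * 0)"
      by (intro tendsto_intros diff inv_b) simp
    then have "(\<lambda>n. 1 / (1 + (v n - b n) * (1 / b n))) \<longlonglongrightarrow> 1" by simp
    then show ?thesis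
    proof (rule Lim_transform_eventually)
      show "\<forall>\<^sub>F n in sequentially. 1 / (1 + (v n - b n) * (1 / b n)) = b n / v n"
        using b_pos by eventually_elim (simp add: field_simps)
    qed
  qed
  have v_top: "filterlim v at_top sequentially"
    using filterlim_tendsto_add_at_top[OF diff b] by simp
  show dens_v: "(\<lambda>n. real n * std_normal_density (v n) / b n) \<longlonglongrightarrow> exp (- y)"
  proof -
    have lim: "(\<lambda>n. real n * std_normal_density (b n) / b n
          * exp (- (b n * (v n - b n) + (v n - b n)\<^sup>2 / 2))) \<longlonglongrightarrow> 1 * exp (- (y + 0\<^sup>2 / 2))"
      by (intro tendsto_intros dens v diff) auto
    have eq: "real n * std_normal_density (b n) / b n * exp (- (b n * (v n - b n) + (v n - b n)\<^sup>2 / 2))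
        = real n * std_normal_density (v n) / b n" for n
    proof -
      have "- ((b n)\<^sup>2 / 2) + - (b n * (v n - b n) + (v n - b n)\<^sup>2 / 2) = - ((v n)\<^sup>2 / 2)"
        by (simp add: power2_eq_square field_simps)
      then have "exp (- ((b n)\<^sup>2 / 2)) * exp (- (b n * (v n - b n) + (v n - b n)\<^sup>2 / 2)) = exp (- ((v n)\<^sup>2 / 2))"
        by (simp only: exp_add[symmetric])
      then show ?thesis
        unfolding std_normal_density_eq by (simp add: mult_ac)
    qed
    show ?thesis
      using lim unfolding eq by simp
  qed
  have tail: "(\<lambda>n. real n * (1 - \<Phi> (v n))) \<longlonglongrightarrow> exp (- y)"
  proof -
    have "(\<lambda>n. (1 - \<Phi> (v n)) * v n / std_normal_density (v n)
        * (real n * std_normal_density (v n) / b n) * (b n / v n)) \<longlonglongrightarrow> 1 * exp (- y) * 1"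
      by (intro tendsto_mult dens_v ratio filterlim_compose[OF mills_ratio v_top])
    then have "(\<lambda>n. (1 - \<Phi> (v n)) * v n / std_normal_density (v n)
        * (real n * std_normal_density (v n) / b n) * (b n / v n)) \<longlonglongrightarrow> exp (- y)" by simp
    then show ?thesis
    proof (rule Lim_transform_eventually)
      show "\<forall>\<^sub>F n in sequentially. (1 - \<Phi> (v n)) * v n / std_normal_density (v n)
          * (real n * std_normal_density (v n) / b n) * (b n / v n) = real n * (1 - \<Phi> (v n))"
        using b_pos filterlim_at_top_dense[THEN iffD1, rule_format, OF v_top, of 0]
      proof eventually_elim
        case (elim n)
        have "std_normal_density (v n) \<noteq> 0"
          by (rule less_imp_neq[OF std_normal_density_pos, symmetric])
        with elim show ?case by simp
      qed
    qed
  qed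
  \<comment> \<open>Both bases lie in the unit ball, so their \<open>n\<close>-th powers differ by at most \<open>n\<close> times their distance.\<close>
  have power: "(\<lambda>n. \<Phi> (v n) ^ n) \<longlonglongrightarrow> exp (- exp (- y))"
  proof -
    have e: "(\<lambda>n. (1 + - exp (- y) / real n) ^ n) \<longlonglongrightarrow> exp (- exp (- y))"
      by (rule tendsto_exp_limit_sequentially)
    have "(\<lambda>n. \<Phi> (v n) ^ n - (1 + - exp (- y) / real n) ^ n) \<longlonglongrightarrow> 0"
    proof (rule Lim_null_comparison)
      show "\<forall>\<^sub>F n in sequentially. norm (\<Phi> (v n) ^ n - (1 + - exp (- y) / real n) ^ n)
          \<le> \<bar>exp (- y) - real n * (1 - \<Phi> (v n))\<bar>"
        using eventually_ge_at_top[of "nat \<lceil>exp (- y)\<rceil>"] eventually_gt_at_top[of 0]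
      proof eventually_elim
        case (elim n)
        then have n: "exp (- y) \<le> real n" "0 < real n" by linarith+
        then have "norm (\<Phi> (v n) ^ n - (1 + - exp (- y) / real n) ^ n)
            \<le> real n * norm (\<Phi> (v n) - (1 + - exp (- y) / real n))"
          using std_normal_cdf_bounds[of "v n"] by (intro norm_power_diff) (auto simp: abs_le_iff)
        also have "\<dots> = \<bar>real n * (\<Phi> (v n) - (1 + - exp (- y) / real n))\<bar>"
          by (simp add: abs_mult)
        also have "real n * (\<Phi> (v n) - (1 + - exp (- y) / real n)) = exp (- y) - real n * (1 - \<Phi> (v n))"
          using n by (simp add: field_simps)
        finally show ?case .
      qed
    next
      show "(\<lambda>n. \<bar>exp (- y) - real n * (1 - \<Phi> (v n))\<bar>) \<longlonglongrightarrow> 0"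
        using tendsto_rabs[OF tendsto_diff[OF tendsto_const[of "exp (- y)"] tail]] by simp
    qed
    from tendsto_add[OF this e] show ?thesis by simp
  qed
  have one: "(\<lambda>n. \<Phi> (v n)) \<longlonglongrightarrow> 1"
    using filterlim_compose[OF std_normal_cdf_at_top v_top] .
  have "(\<lambda>n. \<Phi> (v n) ^ n / \<Phi> (v n)) \<longlonglongrightarrow> exp (- exp (- y)) / 1"
    by (intro tendsto_divide power one) simp
  then have "(\<lambda>n. \<Phi> (v n) ^ n / \<Phi> (v n)) \<longlonglongrightarrow> exp (- exp (- y))" by simp
  then show "(\<lambda>n. \<Phi> (v n) ^ (n - 1)) \<longlonglongrightarrow> exp (- exp (- y))"
  proof (rule Lim_transform_eventually)
    have "\<forall>\<^sub>F n in sequentially. 0 < \<Phi> (v n)"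
      using order_tendstoD(1)[OF one] by simp
    then show "\<forall>\<^sub>F n in sequentially. \<Phi> (v n) ^ n / \<Phi> (v n) = \<Phi> (v n) ^ (n - 1)"
      using eventually_gt_at_top[of 0]
      by eventually_elim (simp add: power_eq_if)
  qed
qed

lemma gumbel_cdf:
  assumes "gumbel_distributed P \<xi>"
  shows "\<P>(\<omega> in P. \<xi> \<omega> \<le> x) = exp (- exp (- x))"
proof -
  have [measurable]: "\<xi> \<in> borel_measurable P" and "cdf (distr P borel \<xi>) x = exp (- exp (- x))"
    using assms by (auto simp: gumbel_distributed_def)
  then show ?thesis
    by (simp add: cdf_def2 measure_distr vimage_def Int_def conj_commute)
qed

lemma gumbel_shift_distributed:
  assumes G: "gumbel_distributed P \<xi>"
  shows "distributed P lborel (\<lambda>\<omega>. \<xi> \<omega> + s) (\<lambda>x. ennreal (exp (- (x - s)) * exp (- exp (- (x - s)))))"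
proof (rule distributed_if_cdf_has_derivative)
  have [measurable]: "\<xi> \<in> borel_measurable P" using G by (simp add: gumbel_distributed_def)
  show "prob_space P" "(\<lambda>\<omega>. \<xi> \<omega> + s) \<in> borel_measurable P"
    using G by (auto simp: gumbel_distributed_def)
  show "\<P>(\<omega> in P. \<xi> \<omega> + s \<le> x) = exp (- exp (- (x - s)))" for x
    using gumbel_cdf[OF G, of "x - s"] by (simp add: le_diff_eq)
  show "((\<lambda>x. exp (- exp (- (x - s)))) has_real_derivative exp (- (x - s)) * exp (- exp (- (x - s)))) (at x)" for x
    by (rule derivative_eq_intros refl | simp)+
qed (auto intro!: continuous_intros)

lemma tv_dist_gumbel_shift_tendsto_0:
  assumes G: "gumbel_distributed P \<xi>" and s: "s \<longlonglongrightarrow> s0"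
  shows "(\<lambda>n. tv_dist P (\<lambda>\<omega>. \<xi> \<omega> + s n) P (\<lambda>\<omega>. \<xi> \<omega> + s0)) \<longlonglongrightarrow> 0"
proof (rule tv_dist_tendsto_0_of_densities)
  show "prob_space P" "prob_space P" using G by (auto simp: gumbel_distributed_def)
  show "\<forall>\<^sub>F n in sequentially. distributed P lborel (\<lambda>\<omega>. \<xi> \<omega> + s n)
      (\<lambda>x. ennreal (exp (- (x - s n)) * exp (- exp (- (x - s n)))))"
    by (intro always_eventually allI gumbel_shift_distributed G)
  show "distributed P lborel (\<lambda>\<omega>. \<xi> \<omega> + s0) (\<lambda>x. ennreal (exp (- (x - s0)) * exp (- exp (- (x - s0)))))"
    by (rule gumbel_shift_distributed[OF G])
  show "(\<lambda>n. exp (- (x - s n)) * exp (- exp (- (x - s n)))) \<longlonglongrightarrow> exp (- (x - s0)) * exp (- exp (- (x - s0)))" for x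
    by (intro tendsto_intros s)
qed auto

text \<open>
  The half-line up to \<open>s / 2\<close>, midway between the two locations, separates the laws
  asymptotically.
\<close>

lemma tv_dist_gumbel_shift_at_bot:
  assumes G: "gumbel_distributed P \<xi>"
  shows "((\<lambda>s. tv_dist P (\<lambda>\<omega>. s + \<xi> \<omega>) P \<xi>) \<longlongrightarrow> 1) at_bot"
proof (rule tendsto_sandwich)
  have P: "prob_space P" using G by (simp add: gumbel_distributed_def)
  show "\<forall>\<^sub>F s in at_bot. exp (- exp (s / 2)) - exp (- exp (- (s / 2))) \<le> tv_dist P (\<lambda>\<omega>. s + \<xi> \<omega>) P \<xi>"
  proof (intro always_eventually allI)
    fix s :: real
    have "\<P>(\<omega> in P. s + \<xi> \<omega> \<in> {..s / 2}) = \<P>(\<omega> in P. \<xi> \<omega> \<le> - (s / 2))"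
      by (intro arg_cong[where f = "measure P"] Collect_cong conj_cong refl) (auto simp: field_simps)
    then have "\<P>(\<omega> in P. s + \<xi> \<omega> \<in> {..s / 2}) = exp (- exp (s / 2))"
      using gumbel_cdf[OF G, of "- (s / 2)"] by simp
    moreover have "\<P>(\<omega> in P. \<xi> \<omega> \<in> {..s / 2}) = exp (- exp (- (s / 2)))"
      using gumbel_cdf[OF G, of "s / 2"] by simp
    ultimately show "exp (- exp (s / 2)) - exp (- exp (- (s / 2))) \<le> tv_dist P (\<lambda>\<omega>. s + \<xi> \<omega>) P \<xi>"
      using tv_dist_upper[OF P P, of "{..s / 2}" "\<lambda>\<omega>. s + \<xi> \<omega>" \<xi>] by simp
  qed
  show "\<forall>\<^sub>F s in at_bot. tv_dist P (\<lambda>\<omega>. s + \<xi> \<omega>) P \<xi> \<le> 1"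
    using tv_dist_le_1[OF P P] by simp
  show "((\<lambda>s::real. exp (- exp (s / 2)) - exp (- exp (- (s / 2)))) \<longlongrightarrow> 1) at_bot"
    by real_asymp
qed simp

text \<open>
  This single statement serves both maxima: the one at a finite time has mean \<open>m\<close> and standard
  deviation \<open>r\<close>, the limiting one has \<open>m = 0\<close>, \<open>r = 1\<close> and hence \<open>s = 0\<close>. The normalised maximum has
  distribution function \<open>\<Phi> (v x) ^ n\<close> with \<open>v x = (b + x / b - m) / r\<close>, and
  \<open>b (v x - b) = (x - (b m - (1 - r) b\<^sup>2)) / r \<longlongrightarrow> x - s\<close>; so its density converges to
  that of \<open>\<xi> + s\<close>.
\<close>

lemma gauss_max_tv_tendsto_gumbel:
  fixes m r :: "nat \<Rightarrow> real"
  defines "b \<equiv> gauss_max_center"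
  assumes M: "\<And>n. prob_space (M n)" and V: "\<forall>\<^sub>F n in sequentially. V n \<in> borel_measurable (M n)"
    and cdf: "\<forall>\<^sub>F n in sequentially. \<forall>x. \<P>(\<omega> in M n. V n \<omega> \<le> x) = \<Phi> ((x - m n) / r n) ^ n"
    and r: "r \<longlonglongrightarrow> 1" and s: "(\<lambda>n. b n * m n - (1 - r n) * (b n)\<^sup>2) \<longlonglongrightarrow> s"
    and G: "gumbel_distributed P \<xi>"
  shows "(\<lambda>n. tv_dist (M n) (\<lambda>\<omega>. b n * V n \<omega> + - (b n)\<^sup>2) P (\<lambda>\<omega>. \<xi> \<omega> + s)) \<longlonglongrightarrow> 0"
proof (rule tv_dist_tendsto_0_of_densities)
  define v where "v n x = (b n + x / b n - m n) / r n" for n x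
  define f where "f n x = \<Phi> (v n x) ^ (n - 1) * (real n * std_normal_density (v n x) / b n) / r n" for n x
  have b: "filterlim b at_top sequentially"
    unfolding b_def by (rule gauss_max_center_at_top)
  then have b_pos: "\<forall>\<^sub>F n in sequentially. 0 < b n"
    by (simp add: filterlim_at_top_dense)
  have r_pos: "\<forall>\<^sub>F n in sequentially. 0 < r n"
    using order_tendstoD(1)[OF r] by simp
  show "\<forall>\<^sub>F n in sequentially. distributed (M n) lborel (\<lambda>\<omega>. b n * V n \<omega> + - (b n)\<^sup>2) (\<lambda>x. ennreal (f n x))"
    using b_pos r_pos V cdf
  proof eventually_elim
    case (elim n)
    note [measurable] = elim(3)
    show ?case
    proof (rule distributed_if_cdf_has_derivative)
      show "prob_space (M n)" by (rule M)
      show "(\<lambda>\<omega>. b n * V n \<omega> + - (b n)\<^sup>2) \<in> borel_measurable (M n)" by simp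
      show "\<P>(\<omega> in M n. b n * V n \<omega> + - (b n)\<^sup>2 \<le> x) = \<Phi> (v n x) ^ n" for x
      proof -
        have "b n * V n \<omega> + - (b n)\<^sup>2 \<le> x \<longleftrightarrow> V n \<omega> \<le> b n + x / b n" for \<omega>
        proof -
          have "b n * V n \<omega> + - (b n)\<^sup>2 \<le> x \<longleftrightarrow> V n \<omega> \<le> (x + (b n)\<^sup>2) / b n"
            using elim(1) by (simp add: pos_le_divide_eq mult.commute algebra_simps)
          also have "(x + (b n)\<^sup>2) / b n = b n + x / b n"
            using elim(1) by (simp add: add_divide_distrib power2_eq_square)
          finally show ?thesis .
        qed
        then show ?thesis
          using elim(4) by (simp add: v_def)
      qed
      show "((\<lambda>x. \<Phi> (v n x) ^ n) has_real_derivative f n x) (at x)" for x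
      proof -
        have "((\<lambda>x. v n x) has_real_derivative 1 / b n / r n) (at x)"
          unfolding v_def by (intro DERIV_cdivide) (use elim(1) in \<open>auto intro!: derivative_eq_intros\<close>)
        from DERIV_power[OF DERIV_std_normal_cdf[OF this], of n] show ?thesis
          by (simp add: f_def mult_ac)
      qed
      have cont_v: "continuous_on UNIV (v n)"
        unfolding v_def using elim(1,2) by (intro continuous_intros) simp_all
      have "continuous_on UNIV \<Phi>"
        by (intro continuous_at_imp_continuous_on ballI DERIV_isCont[OF DERIV_std_normal_cdf[OF DERIV_ident]])
      then have "continuous_on UNIV (\<lambda>x. \<Phi> (v n x))"
        by (rule continuous_on_compose2[OF _ cont_v]) simp
      then show "continuous_on UNIV (f n)"
        unfolding f_def std_normal_density_eq using elim(1,2)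
        by (intro continuous_intros cont_v) simp_all
      show "0 \<le> f n x" for x
        using elim(1,2) std_normal_cdf_bounds by (simp add: f_def)
    qed
  qed
  show "\<forall>\<^sub>F n in sequentially. \<forall>x. 0 \<le> f n x"
    using b_pos r_pos by eventually_elim (use std_normal_cdf_bounds in \<open>simp add: f_def\<close>)
  show "(\<lambda>n. f n x) \<longlonglongrightarrow> exp (- (x - s)) * exp (- exp (- (x - s)))" for x
  proof -
    have "(\<lambda>n. (x - (b n * m n - (1 - r n) * (b n)\<^sup>2)) / r n) \<longlonglongrightarrow> (x - s) / 1"
      by (intro tendsto_intros s r) simp
    then have "(\<lambda>n. (x - (b n * m n - (1 - r n) * (b n)\<^sup>2)) / r n) \<longlonglongrightarrow> x - s" by simp
    then have "(\<lambda>n. b n * (v n x - b n)) \<longlonglongrightarrow> x - s"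
    proof (rule Lim_transform_eventually)
      show "\<forall>\<^sub>F n in sequentially. (x - (b n * m n - (1 - r n) * (b n)\<^sup>2)) / r n = b n * (v n x - b n)"
        using b_pos r_pos
      proof eventually_elim
        case (elim n)
        then have "b n * (b n + x / b n - m n) - r n * (b n)\<^sup>2 = x - (b n * m n - (1 - r n) * (b n)\<^sup>2)"
          by (simp add: algebra_simps power2_eq_square)
        moreover have "b n * (v n x - b n) = (b n * (b n + x / b n - m n) - r n * (b n)\<^sup>2) / r n"
          using elim(2) by (simp add: v_def diff_divide_distrib right_diff_distrib power2_eq_square)
        ultimately show ?case by simp
      qed
    qed
    note tail = gauss_max_limits[OF b gauss_max_center_density[folded b_def] this]
    have "(\<lambda>n. f n x) \<longlonglongrightarrow> exp (- exp (- (x - s))) * exp (- (x - s)) / 1"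
      unfolding f_def by (intro tendsto_divide tendsto_mult tail r) simp
    then show ?thesis by (simp add: mult.commute)
  qed
qed (use G M gumbel_shift_distributed[OF G] in \<open>auto simp: gumbel_distributed_def\<close>)

section \<open>The integral equation on a single path\<close>

text \<open>
  One-sided limits bound the path near each point, and a bisection argument patches these local bounds
  together.
\<close>

lemma cadlag_bounded:
  assumes "cadlag f" "0 \<le> t"
  shows "\<exists>B. \<forall>s\<in>{0..t}. \<bar>f s\<bar> \<le> B"
proof -
  define Q where "Q a b \<longleftrightarrow> (\<exists>B. \<forall>u. a \<le> u \<and> u \<le> b \<and> 0 \<le> u \<longrightarrow> \<bar>f u\<bar> \<le> B)" for a b
  have "Q 0 t"
  proof (rule Bolzano[OF assms(2)])
    fix a b c assume Q: "Q a b" "Q b c" "a \<le> b" "b \<le> c"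
    then obtain B B' where B: "\<And>u. a \<le> u \<and> u \<le> b \<and> 0 \<le> u \<Longrightarrow> \<bar>f u\<bar> \<le> B"
      and B': "\<And>u. b \<le> u \<and> u \<le> c \<and> 0 \<le> u \<Longrightarrow> \<bar>f u\<bar> \<le> B'"
      unfolding Q_def by blast
    have "\<bar>f u\<bar> \<le> max B B'" if "a \<le> u \<and> u \<le> c \<and> 0 \<le> u" for u
      using B[of u] B'[of u] that by (cases "u \<le> b") auto
    then show "Q a c"
      unfolding Q_def by blast
  next
    fix x assume x: "0 \<le> x" "x \<le> t"
    have bound: "\<forall>\<^sub>F u in F. \<bar>f u\<bar> < \<bar>l\<bar> + 1" if "(f \<longlongrightarrow> l) F" for l F
      using order_tendstoD(2)[OF tendsto_rabs[OF that], of "\<bar>l\<bar> + 1"] by simp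
    have "(f \<longlongrightarrow> f x) (at_right x)"
      using assms(1) x by (simp add: cadlag_def)
    from bound[OF this] obtain r where r: "r > x" "\<And>u. x < u \<Longrightarrow> u < r \<Longrightarrow> \<bar>f u\<bar> < \<bar>f x\<bar> + 1"
      unfolding eventually_at_right_field by blast
    have "\<exists>p B. p < x \<and> (\<forall>u. p < u \<and> u < x \<and> 0 \<le> u \<longrightarrow> \<bar>f u\<bar> \<le> B)"
    proof (cases "x = 0")
      case True
      then show ?thesis by (intro exI[of _ "-1"]) auto
    next
      case False
      then obtain l where "(f \<longlongrightarrow> l) (at_left x)"
        using assms(1) x unfolding cadlag_def by (metis order_le_less)
      from bound[OF this] obtain p where "p < x" "\<And>u. p < u \<Longrightarrow> u < x \<Longrightarrow> \<bar>f u\<bar> < \<bar>l\<bar> + 1"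
        unfolding eventually_at_left_field by blast
      then show ?thesis
        by (intro exI[of _ p] exI[of _ "\<bar>l\<bar> + 1"]) (auto intro: less_imp_le)
    qed
    then obtain p B where p: "p < x" "\<And>u. p < u \<Longrightarrow> u < x \<Longrightarrow> 0 \<le> u \<Longrightarrow> \<bar>f u\<bar> \<le> B"
      by blast
    show "\<exists>d>0. \<forall>a b. a \<le> x \<and> x \<le> b \<and> b - a < d \<longrightarrow> Q a b"
    proof (intro exI conjI allI impI)
      show "0 < min (r - x) (x - p)" using r(1) p(1) by simp
      fix a b assume ab: "a \<le> x \<and> x \<le> b \<and> b - a < min (r - x) (x - p)"
      have "\<bar>f u\<bar> \<le> max B (\<bar>f x\<bar> + 1)" if u: "a \<le> u \<and> u \<le> b \<and> 0 \<le> u" for u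
      proof (cases u x rule: linorder_cases)
        case less
        then show ?thesis using p(2)[of u] u ab by auto
      next
        case greater
        then show ?thesis using r(2)[of u] u ab by auto
      qed auto
      then show "Q a b" unfolding Q_def by blast
    qed
  qed
  then show ?thesis unfolding Q_def by (metis atLeastAtMost_iff)
qed

lemma cadlag_LIMSEQ_right:
  assumes "cadlag f" "0 \<le> s" and u: "u \<longlonglongrightarrow> s" "\<forall>\<^sub>F n in sequentially. s \<le> u n"
  shows "(\<lambda>n. f (u n)) \<longlonglongrightarrow> f s"
proof -
  have "(f \<longlongrightarrow> f s) (at_right s)"
    using assms(1,2) by (simp add: cadlag_def)
  then have "(f \<longlongrightarrow> f s) (at s within {s..})"
    by (simp add: at_within_Ici_at_right)
  then have "continuous (at s within {s..}) f"
    by (simp add: continuous_within)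
  moreover have "\<forall>\<^sub>F n in sequentially. u n \<in> {s..}"
    using u(2) by simp
  ultimately show ?thesis
    using u(1) by (rule continuous_within_tendsto_compose)
qed

text \<open>
  Rounding upwards, not downwards, makes right-continuity alone enough for \<open>x (grid_above h s) \<longlongrightarrow> x s\<close>
  at every \<open>s\<close>; rounding down would lead to left limits and require that the jumps form a null set.
\<close>

definition grid_above :: "real \<Rightarrow> real \<Rightarrow> real" where
  "grid_above h s = of_int \<lceil>s / h\<rceil> * h"

lemma grid_above_bounds:
  assumes "h > 0"
  shows "s \<le> grid_above h s" "grid_above h s < s + h"
proof -
  have "s / h \<le> of_int \<lceil>s / h\<rceil>" "of_int \<lceil>s / h\<rceil> < s / h + 1" by linarith+
  then have "s / h * h \<le> of_int \<lceil>s / h\<rceil> * h" "of_int \<lceil>s / h\<rceil> * h < (s / h + 1) * h"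
    using assms by (intro mult_right_mono mult_strict_right_mono; simp)+
  then show "s \<le> grid_above h s" "grid_above h s < s + h"
    using assms by (simp_all add: grid_above_def distrib_right)
qed

lemma grid_above_eq:
  assumes "h > 0" "real k * h < s" "s \<le> real (Suc k) * h"
  shows "grid_above h s = real (Suc k) * h"
proof -
  have "real k < s / h" "s / h \<le> real (Suc k)"
    using assms by (simp_all only: pos_less_divide_eq pos_divide_le_eq)
  then have "\<lceil>s / h\<rceil> = int (Suc k)"
    by (intro ceiling_unique) simp_all
  then show ?thesis by (simp add: grid_above_def)
qed

lemma grid_above_le:
  assumes "n > 0" "t > 0" "s \<le> t"
  shows "grid_above (t / real n) s \<le> t"
proof -
  have "s / (t / real n) \<le> of_int (int n)"
    using assms by (simp add: pos_divide_le_eq mult.commute)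
  then have "\<lceil>s / (t / real n)\<rceil> \<le> int n"
    by (rule ceiling_le)
  then have "real_of_int \<lceil>s / (t / real n)\<rceil> \<le> real n" by linarith
  then have "real_of_int \<lceil>s / (t / real n)\<rceil> * (t / real n) \<le> real n * (t / real n)"
    using assms by (intro mult_right_mono) simp_all
  then show ?thesis using assms(1) by (simp add: grid_above_def)
qed

lemma grid_above_tendsto: "(\<lambda>n. grid_above (t / real n) s) \<longlonglongrightarrow> s" if "t > 0"
proof (rule tendsto_sandwich)
  show "\<forall>\<^sub>F n in sequentially. s \<le> grid_above (t / real n) s"
    using eventually_gt_at_top[of 0]
    by eventually_elim (rule grid_above_bounds, use that in simp)
  show "\<forall>\<^sub>F n in sequentially. grid_above (t / real n) s \<le> s + t / real n"
    using eventually_gt_at_top[of 0]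
    by eventually_elim (rule less_imp_le, rule grid_above_bounds, use that in simp)
  show "(\<lambda>n. s + t / real n) \<longlonglongrightarrow> s"
    using tendsto_add[OF tendsto_const lim_const_over_n[of t]] by simp
qed simp

lemma grid_above_comp_measurable [measurable]: "(\<lambda>s. f (grid_above h s)) \<in> borel_measurable borel"
  for f :: "real \<Rightarrow> real"
proof -
  have "(\<lambda>k::int. f (of_int k * h)) \<in> measurable (count_space UNIV) borel" by simp
  from measurable_compose[OF _ this, of "\<lambda>s. \<lceil>s / h\<rceil>" borel]
  show ?thesis by (simp add: grid_above_def)
qed

lemma cadlag_grid_tendsto:
  assumes "cadlag f" "0 \<le> s" "t > 0"
  shows "(\<lambda>n. f (grid_above (t / real n) s)) \<longlonglongrightarrow> f s"
proof (rule cadlag_LIMSEQ_right[OF assms(1,2) grid_above_tendsto[OF assms(3)]])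
  show "\<forall>\<^sub>F n in sequentially. s \<le> grid_above (t / real n) s"
    using eventually_gt_at_top[of 0]
    by eventually_elim (rule grid_above_bounds, use assms in simp)
qed

lemma cadlag_indicator_measurable:
  assumes "cadlag f" "t > 0"
  shows "(\<lambda>s. indicator {0..t} s * f s) \<in> borel_measurable borel"
proof (rule borel_measurable_LIMSEQ_real)
  show "(\<lambda>n. indicator {0..t} s * f (grid_above (t / real n) s)) \<longlonglongrightarrow> indicator {0..t} s * f s" for s
    using cadlag_grid_tendsto[OF assms(1) _ assms(2), of s] by (auto split: split_indicator)
qed simp

lemma cadlag_set_integrable:
  assumes "cadlag f" "t > 0"
  shows "set_integrable lborel {0..t} f"
proof -
  obtain B where B: "\<And>s. s \<in> {0..t} \<Longrightarrow> \<bar>f s\<bar> \<le> B"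
    using cadlag_bounded[OF assms(1) less_imp_le[OF assms(2)]] by blast
  show ?thesis
    unfolding set_integrable_def
  proof (rule Bochner_Integration.integrable_bound[where f = "\<lambda>s. indicator {0..t} s * B"])
    show "integrable lborel (\<lambda>s. indicator {0..t} s * B)"
      by (intro integrable_mult_left integrable_real_indicator) (simp_all add: emeasure_lborel_Icc_eq)
    show "(\<lambda>s. indicator {0..t} s *\<^sub>R f s) \<in> borel_measurable lborel"
      using cadlag_indicator_measurable[OF assms] by simp
    show "AE s in lborel. norm (indicator {0..t} s *\<^sub>R f s) \<le> norm (indicator {0..t} s * B)"
      using B by (auto split: split_indicator intro!: AE_I2 order_trans[OF B abs_ge_self])
  qed
qed

lemma cadlag_grid_set_integrable:
  assumes "cadlag f" "t > 0" "n > 0"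
  shows "set_integrable lborel {0..t} (\<lambda>s. f (grid_above (t / real n) s))"
proof -
  obtain B where B: "\<And>s. s \<in> {0..t} \<Longrightarrow> \<bar>f s\<bar> \<le> B"
    using cadlag_bounded[OF assms(1) less_imp_le[OF assms(2)]] by blast
  have g: "grid_above (t / real n) s \<in> {0..t}" if "s \<in> {0..t}" for s
    using that grid_above_bounds[of "t / real n" s] grid_above_le[OF assms(3,2), of s] assms by auto
  show ?thesis
    unfolding set_integrable_def
  proof (rule Bochner_Integration.integrable_bound[where f = "\<lambda>s. indicator {0..t} s * B"])
    show "integrable lborel (\<lambda>s. indicator {0..t} s * B)"
      by (intro integrable_mult_left integrable_real_indicator) (simp_all add: emeasure_lborel_Icc_eq)
    show "(\<lambda>s. indicator {0..t} s *\<^sub>R f (grid_above (t / real n) s)) \<in> borel_measurable lborel"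
      by simp
    show "AE s in lborel. norm (indicator {0..t} s *\<^sub>R f (grid_above (t / real n) s))
        \<le> norm (indicator {0..t} s * B)"
      using B[OF g] by (auto split: split_indicator intro!: AE_I2 order_trans[OF B[OF g] abs_ge_self])
  qed
qed

text \<open>
  Dominated convergence: pointwise convergence comes from right-continuity, the dominating constant from
  boundedness.
\<close>

lemma cadlag_grid_L1_tendsto_0:
  assumes "cadlag f" "t > 0"
  shows "(\<lambda>n. LINT s:{0..t}|lborel. \<bar>f s - f (grid_above (t / real n) s)\<bar>) \<longlonglongrightarrow> 0"
proof -
  obtain B where B: "\<And>s. s \<in> {0..t} \<Longrightarrow> \<bar>f s\<bar> \<le> B"
    using cadlag_bounded[OF assms(1) less_imp_le[OF assms(2)]] by blast
  let ?F = "\<lambda>n s. indicator {0..t} s *\<^sub>R \<bar>f s - f (grid_above (t / real n) s)\<bar>"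
  have "(\<lambda>n. \<integral>s. ?F (Suc n) s \<partial>lborel) \<longlonglongrightarrow> (\<integral>s. 0 \<partial>(lborel :: real measure))"
  proof (rule integral_dominated_convergence[where w = "\<lambda>s. indicator {0..t} s * (2 * B)"])
    fix n :: nat
    have "?F (Suc n) s = \<bar>indicator {0..t} s * f s - indicator {0..t} s * f (grid_above (t / real (Suc n)) s)\<bar>" for s
      by (simp split: split_indicator)
    then show "?F (Suc n) \<in> borel_measurable lborel"
      using cadlag_indicator_measurable[OF assms] by simp
    have "norm (?F (Suc n) s) \<le> indicator {0..t} s * (2 * B)" for s
    proof (cases "s \<in> {0..t}")
      case True
      then have "grid_above (t / real (Suc n)) s \<in> {0..t}"
        using grid_above_bounds[of "t / real (Suc n)" s] grid_above_le[of "Suc n" t s] assms(2) by auto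
      from B[OF this] B[OF True] True show ?thesis by simp
    qed simp
    then show "AE s in lborel. norm (?F (Suc n) s) \<le> indicator {0..t} s * (2 * B)" by simp
  next
    have "(\<lambda>n. ?F n s) \<longlonglongrightarrow> 0" for s
    proof (cases "s \<in> {0..t}")
      case True
      then have "(\<lambda>n. \<bar>f s - f (grid_above (t / real n) s)\<bar>) \<longlonglongrightarrow> \<bar>f s - f s\<bar>"
        using cadlag_grid_tendsto[OF assms(1) _ assms(2), of s] by (intro tendsto_intros) simp
      then show ?thesis using True by simp
    qed simp
    then have "(\<lambda>n. ?F (Suc n) s) \<longlonglongrightarrow> 0" for s
      by (rule LIMSEQ_Suc)
    then show "AE s in lborel. (\<lambda>n. ?F (Suc n) s) \<longlonglongrightarrow> 0" by simp
    show "integrable lborel (\<lambda>s. indicator {0..t} s * (2 * B))"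
      by (intro integrable_mult_left integrable_real_indicator) (simp_all add: emeasure_lborel_Icc_eq)
  qed simp
  then have "(\<lambda>n. \<integral>s. ?F (Suc n) s \<partial>lborel) \<longlonglongrightarrow> 0" by simp
  then show ?thesis
    unfolding set_lebesgue_integral_def by (rule LIMSEQ_imp_Suc)
qed

text \<open>
  With \<open>x_k = x (k h)\<close>, the equation over one step of the grid reads
  \<open>(1 + lam h) x_(k+1) = x_k + (l ((k+1) h) - l (k h)) - lam e_k\<close>, where \<open>e_k\<close> is the integral of
  \<open>x - x \<circ> grid_above h\<close> over that step. The implicit Euler scheme \<open>Y\<close> solves the same recursion
  without \<open>e_k\<close>, and multiplication by \<open>q \<le> 1\<close> does not amplify errors, so they merely add up.
\<close>

lemma implicit_euler_error:
  fixes x l :: "real \<Rightarrow> real"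
  assumes x: "cadlag x" and "lam > 0" "t > 0" "n > 0"
    and eq: "\<And>s. 0 \<le> s \<Longrightarrow> x s = x0 - lam * (LINT u:{0..s}|lborel. x u) + l s"
    and l0: "l 0 = 0"
  defines "h \<equiv> t / real n"
  defines "q \<equiv> 1 / (1 + lam * h)"
  shows "\<bar>x t - (q ^ n * x0 + (\<Sum>k<n. q ^ (n - k) * (l (real (Suc k) * h) - l (real k * h))))\<bar>
    \<le> lam * (LINT s:{0..t}|lborel. \<bar>x s - x (grid_above h s)\<bar>)"
proof -
  define Y where "Y k = q ^ k * x0 + (\<Sum>j<k. q ^ (k - j) * (l (real (Suc j) * h) - l (real j * h)))" for k
  define e where "e s = x s - x (grid_above h s)" for s
  have h: "0 < h" using assms by (simp add: h_def)
  have q: "0 < q" "q \<le> 1" using h \<open>lam > 0\<close> by (simp_all add: q_def add_pos_nonneg)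
  have int_x: "set_integrable lborel {0..t} x"
    by (rule cadlag_set_integrable[OF x \<open>t > 0\<close>])
  have int_e: "set_integrable lborel {0..t} e"
    unfolding e_def h_def
    by (rule set_integral_diff(1)[OF int_x cadlag_grid_set_integrable[OF x \<open>t > 0\<close> \<open>n > 0\<close>]])
  have int_abs: "set_integrable lborel {0..t} (\<lambda>s. \<bar>e s\<bar>)"
    by (rule set_integrable_abs[OF int_e])
  \<comment> \<open>The closed form of the scheme satisfies its recursion.\<close>
  have Y_Suc: "Y (Suc k) = q * (Y k + (l (real (Suc k) * h) - l (real k * h)))" for k
  proof -
    have "(\<Sum>j<k. q ^ (Suc k - j) * (l (real (Suc j) * h) - l (real j * h)))
        = q * (\<Sum>j<k. q ^ (k - j) * (l (real (Suc j) * h) - l (real j * h)))"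
      unfolding sum_distrib_left by (rule sum.cong) (auto simp: Suc_diff_le)
    then show ?thesis by (simp add: Y_def algebra_simps)
  qed
  have split: "(LINT s:{0..real (Suc k) * h}|lborel. f s)
      = (LINT s:{0..real k * h}|lborel. f s) + (LINT s:{real k * h<..real (Suc k) * h}|lborel. f s)"
    if f: "set_integrable lborel {0..t} f" and k: "k < n" for f :: "real \<Rightarrow> real" and k
  proof -
    have "real (Suc k) * h \<le> real n * h"
      using k h by (intro mult_right_mono) simp_all
    then have le: "real (Suc k) * h \<le> t" using \<open>n > 0\<close> by (simp add: h_def)
    have nn: "0 \<le> real k * h" using h by simp
    have sub: "{real k * h<..real (Suc k) * h} \<subseteq> {0..t}"
      unfolding subset_iff atLeastAtMost_iff greaterThanAtMost_iff using nn le by linarith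
    have un: "{0..real (Suc k) * h} = {0..real k * h} \<union> {real k * h<..real (Suc k) * h}"
    proof (rule set_eqI)
      fix s
      have "real k * h \<le> real (Suc k) * h" using h by (simp add: distrib_right)
      then show "s \<in> {0..real (Suc k) * h} \<longleftrightarrow> s \<in> {0..real k * h} \<union> {real k * h<..real (Suc k) * h}"
        unfolding Un_iff atLeastAtMost_iff greaterThanAtMost_iff using nn by linarith
    qed
    show ?thesis
      unfolding un
    proof (rule set_integral_Un)
      show "set_integrable lborel {0..real k * h} f"
        by (rule set_integrable_subset[OF f]) (use le h in \<open>auto simp: distrib_right\<close>)
      show "set_integrable lborel {real k * h<..real (Suc k) * h} f"
        by (rule set_integrable_subset[OF f])
          (use sub in simp_all)
    qed auto
  qed
  have "\<bar>x (real k * h) - Y k\<bar> \<le> lam * (LINT s:{0..real k * h}|lborel. \<bar>e s\<bar>)" if "k \<le> n" for k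
    using that
  proof (induction k)
    case 0
    have "x 0 = x0"
    proof -
      have "(LINT u:{0..0}|lborel. x u) = 0"
        unfolding set_lebesgue_integral_def
      proof (rule integral_eq_zero_AE)
        show "AE u in lborel. indicator {0..0} u *\<^sub>R x u = 0"
          using AE_lborel_singleton[of "0::real"] by eventually_elim (simp split: split_indicator)
      qed
      then show ?thesis using eq[of 0] l0 by simp
    qed
    moreover have "0 \<le> (LINT s:{0}|lborel. \<bar>e s\<bar>)"
      unfolding set_lebesgue_integral_def by (rule Bochner_Integration.integral_nonneg) simp
    ultimately show ?case using \<open>lam > 0\<close> by (simp add: Y_def)
  next
    case (Suc k)
    then have k: "k < n" and IH: "\<bar>x (real k * h) - Y k\<bar> \<le> lam * (LINT s:{0..real k * h}|lborel. \<bar>e s\<bar>)"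
      by auto
    define I where "I = {real k * h<..real (Suc k) * h}"
    have IT: "I \<subseteq> {0..t}"
    proof -
      have "real (Suc k) * h \<le> real n * h"
        using k h by (intro mult_right_mono) simp_all
      then have "real (Suc k) * h \<le> t" using \<open>n > 0\<close> by (simp add: h_def)
      moreover have "0 \<le> real k * h" using h by simp
      ultimately show ?thesis unfolding I_def by auto
    qed
    have int_eI: "set_integrable lborel I e"
      by (rule set_integrable_subset[OF int_e _ IT]) (simp add: I_def)
    \<comment> \<open>On this step the grid point above \<open>s\<close> is always the right endpoint.\<close>
    have "(LINT s:I|lborel. x s) = (LINT s:I|lborel. e s + x (real (Suc k) * h))"
      by (rule set_lebesgue_integral_cong)
        (auto simp: I_def e_def grid_above_eq[OF h])
    also have "\<dots> = (LINT s:I|lborel. e s) + (LINT s:I|lborel. x (real (Suc k) * h))"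
    proof (rule set_integral_add(2)[OF int_eI])
      show "set_integrable lborel I (\<lambda>_. x (real (Suc k) * h))"
        unfolding I_def set_integrable_def using h
        by (intro integrable_scaleR_left integrable_real_indicator) (simp_all add: emeasure_lborel_Ioc distrib_right)
    qed
    also have "(LINT s:I|lborel. x (real (Suc k) * h)) = h * x (real (Suc k) * h)"
      using h by (simp add: I_def set_lebesgue_integral_def distrib_right)
    finally have Ix: "(LINT s:I|lborel. x s) = (LINT s:I|lborel. e s) + h * x (real (Suc k) * h)" .
    have pos: "0 \<le> real (Suc k) * h" "0 \<le> real k * h" using h by simp_all
    have "x (real (Suc k) * h) - x (real k * h)
        = - lam * (LINT s:I|lborel. x s) + (l (real (Suc k) * h) - l (real k * h))"
      using split[OF int_x k] unfolding eq[OF pos(1)] eq[OF pos(2)] I_def by (simp add: algebra_simps)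
    then have "(1 + lam * h) * x (real (Suc k) * h)
        = x (real k * h) + (l (real (Suc k) * h) - l (real k * h)) - lam * (LINT s:I|lborel. e s)"
      unfolding Ix by (simp add: algebra_simps)
    then have "x (real (Suc k) * h)
        = q * (x (real k * h) + (l (real (Suc k) * h) - l (real k * h)) - lam * (LINT s:I|lborel. e s))"
      using q(1) unfolding q_def by (simp add: nonzero_eq_divide_eq mult.commute)
    then have "x (real (Suc k) * h) - Y (Suc k) = q * ((x (real k * h) - Y k) - lam * (LINT s:I|lborel. e s))"
      unfolding Y_Suc by (simp add: algebra_simps)
    then have "\<bar>x (real (Suc k) * h) - Y (Suc k)\<bar> = q * \<bar>(x (real k * h) - Y k) - lam * (LINT s:I|lborel. e s)\<bar>"
      using q(1) by (simp add: abs_mult)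
    also have "\<dots> \<le> 1 * \<bar>(x (real k * h) - Y k) - lam * (LINT s:I|lborel. e s)\<bar>"
      using q(2) by (intro mult_right_mono) auto
    also have "\<dots> \<le> \<bar>x (real k * h) - Y k\<bar> + lam * \<bar>LINT s:I|lborel. e s\<bar>"
      using abs_triangle_ineq4[of "x (real k * h) - Y k" "lam * (LINT s:I|lborel. e s)"] \<open>lam > 0\<close>
      by (simp add: abs_mult)
    also have "\<bar>LINT s:I|lborel. e s\<bar> \<le> (LINT s:I|lborel. \<bar>e s\<bar>)"
      using set_integral_norm_bound[OF int_eI] by simp
    finally have "\<bar>x (real (Suc k) * h) - Y (Suc k)\<bar>
        \<le> lam * (LINT s:{0..real k * h}|lborel. \<bar>e s\<bar>) + lam * (LINT s:I|lborel. \<bar>e s\<bar>)"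
      using IH \<open>lam > 0\<close> by simp
    then show ?case
      using split[OF int_abs k] unfolding I_def by (simp add: distrib_left)
  qed
  from this[of n] show ?thesis
    using \<open>n > 0\<close> by (simp add: Y_def e_def h_def)
qed

lemma implicit_euler_tendsto:
  fixes x l :: "real \<Rightarrow> real"
  assumes x: "cadlag x" and "lam > 0" "t > 0"
    and eq: "\<And>s. 0 \<le> s \<Longrightarrow> x s = x0 - lam * (LINT u:{0..s}|lborel. x u) + l s"
    and l0: "l 0 = 0"
  defines "q \<equiv> \<lambda>n. 1 / (1 + lam * (t / real n))"
  shows "(\<lambda>n. q n ^ n * x0 + (\<Sum>k<n. q n ^ (n - k) * (l (real (Suc k) * (t / real n)) - l (real k * (t / real n)))))
    \<longlonglongrightarrow> x t"
proof (rule LIM_zero_cancel, rule Lim_null_comparison)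
  show "\<forall>\<^sub>F n in sequentially. norm (q n ^ n * x0
        + (\<Sum>k<n. q n ^ (n - k) * (l (real (Suc k) * (t / real n)) - l (real k * (t / real n)))) - x t)
      \<le> lam * (LINT s:{0..t}|lborel. \<bar>x s - x (grid_above (t / real n) s)\<bar>)"
    using eventually_gt_at_top[of 0]
  proof eventually_elim
    case (elim n)
    from implicit_euler_error[OF x \<open>lam > 0\<close> \<open>t > 0\<close> elim eq l0]
    show ?case unfolding q_def real_norm_def by (subst abs_minus_commute)
  qed
  show "(\<lambda>n. lam * (LINT s:{0..t}|lborel. \<bar>x s - x (grid_above (t / real n) s)\<bar>)) \<longlonglongrightarrow> 0"
    using tendsto_mult[OF tendsto_const[of lam] cadlag_grid_L1_tendsto_0[OF x \<open>t > 0\<close>]] by simp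
qed

section \<open>Laws of the driving process and of its Ornstein--Uhlenbeck process\<close>

lemma (in prob_space) char_tendsto_AE:
  fixes U :: "nat \<Rightarrow> 'a \<Rightarrow> real"
  assumes U [measurable]: "\<And>n. U n \<in> borel_measurable M" and V [measurable]: "V \<in> borel_measurable M"
    and lim: "AE \<omega> in M. (\<lambda>n. U n \<omega>) \<longlonglongrightarrow> V \<omega>"
  shows "(\<lambda>n. char (distr M borel (U n)) z) \<longlonglongrightarrow> char (distr M borel V) z"
proof -
  have "(\<lambda>n. CLINT \<omega>|M. iexp (z * U n \<omega>)) \<longlonglongrightarrow> (CLINT \<omega>|M. iexp (z * V \<omega>))"
  proof (rule integral_dominated_convergence[where w = "\<lambda>_. 1"])
    show "AE \<omega> in M. (\<lambda>n. iexp (z * U n \<omega>)) \<longlonglongrightarrow> iexp (z * V \<omega>)"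
      using lim by eventually_elim (intro tendsto_intros)
  qed simp_all
  then show ?thesis by (simp add: char_def integral_distr)
qed

lemma (in prob_space) char_distr_affine:
  fixes U :: "'a \<Rightarrow> real"
  assumes [measurable]: "U \<in> borel_measurable M"
  shows "char (distr M borel (\<lambda>\<omega>. m + a * U \<omega>)) z = iexp (z * m) * char (distr M borel U) (a * z)"
proof -
  have "char (distr M borel (\<lambda>\<omega>. m + a * U \<omega>)) z = (CLINT \<omega>|M. iexp (z * m) * iexp (a * z * U \<omega>))"
    by (simp add: char_def integral_distr exp_add[symmetric] algebra_simps)
  also have "\<dots> = iexp (z * m) * (CLINT \<omega>|M. iexp (a * z * U \<omega>))"
    by simp
  finally show ?thesis by (simp add: char_def integral_distr)
qed

text \<open>
  By Levy's uniqueness theorem \<open>U\<close> has the law of an affine image of a standard normal variable.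
\<close>

lemma (in prob_space) gaussian_cdf_of_char:
  fixes U :: "'a \<Rightarrow> real"
  assumes U [measurable]: "U \<in> borel_measurable M" and "\<sigma> > 0"
    and char: "\<And>z. char (distr M borel U) z = iexp (z * m) * exp (- complex_of_real ((\<sigma> * z)\<^sup>2 / 2))"
  shows "\<P>(\<omega> in M. U \<omega> \<le> x) = \<Phi> ((x - m) / \<sigma>)"
proof -
  interpret S: real_distribution std_normal_distribution
    by (rule real_dist_normal_dist)
  have id: "distr std_normal_distribution borel (\<lambda>y. y) = std_normal_distribution"
    by (rule distr_id2) simp
  have "distr M borel U = distr std_normal_distribution borel (\<lambda>y. m + \<sigma> * y)"
  proof (rule Levy_uniqueness)
    show "char (distr M borel U) = char (distr std_normal_distribution borel (\<lambda>y. m + \<sigma> * y))"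
    proof
      fix z
      show "char (distr M borel U) z = char (distr std_normal_distribution borel (\<lambda>y. m + \<sigma> * y)) z"
        using S.char_distr_affine[of "\<lambda>y. y" m \<sigma> z] char[of z]
        by (simp add: id char_std_normal_distribution exp_of_real[symmetric])
    qed
  qed simp_all
  then have "measure (distr M borel U) {..x} = measure (distr std_normal_distribution borel (\<lambda>y. m + \<sigma> * y)) {..x}"
    by simp
  moreover have "measure (distr M borel U) {..x} = \<P>(\<omega> in M. U \<omega> \<le> x)"
    by (simp add: measure_distr vimage_def Int_def conj_commute)
  moreover have "measure (distr std_normal_distribution borel (\<lambda>y. m + \<sigma> * y)) {..x} = measure std_normal_distribution {..(x - m) / \<sigma>}"
  proof -
    have "(\<lambda>y. m + \<sigma> * y) -` {..x} = {..(x - m) / \<sigma>}"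
      using \<open>\<sigma> > 0\<close> by (auto simp: pos_le_divide_eq algebra_simps)
    then show ?thesis by (simp add: measure_distr)
  qed
  ultimately show ?thesis by (simp add: cdf_def)
qed

lemma levy_grid_increments:
  assumes L: "levy_process M L" and h: "h > 0"
  shows "prob_space.indep_vars M (\<lambda>_. borel) (\<lambda>k \<omega>. L (real (Suc k) * h) \<omega> - L (real k * h) \<omega>) {..<n}"
    and "distr M borel (\<lambda>\<omega>. L (real (Suc k) * h) \<omega> - L (real k * h) \<omega>) = distr M borel (L h)"
proof -
  have 1: "\<And>(n::nat) \<tau>. 0 \<le> \<tau> 0 \<Longrightarrow> (\<forall>i<n. \<tau> i < \<tau> (Suc i)) \<Longrightarrow>
        prob_space.indep_vars M (\<lambda>_. borel) (\<lambda>i \<omega>. L (\<tau> (Suc i)) \<omega> - L (\<tau> i) \<omega>) {..<n}"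
    and 2: "\<And>s h. s \<ge> 0 \<Longrightarrow> h \<ge> 0 \<Longrightarrow> distr M borel (\<lambda>\<omega>. L (s + h) \<omega> - L s \<omega>) = distr M borel (L h)"
    using L unfolding levy_process_def by blast+
  show "prob_space.indep_vars M (\<lambda>_. borel) (\<lambda>k \<omega>. L (real (Suc k) * h) \<omega> - L (real k * h) \<omega>) {..<n}"
    by (rule 1[of "\<lambda>k. real k * h"]) (use h in \<open>simp_all add: distrib_right\<close>)
  have "real (Suc k) * h = real k * h + h" by (simp add: distrib_right)
  then show "distr M borel (\<lambda>\<omega>. L (real (Suc k) * h) \<omega> - L (real k * h) \<omega>) = distr M borel (L h)"
    using 2[of "real k * h" h] h by simp
qed

text \<open>
  The weights are those of the Euler scheme; constant weights give back \<open>L\<close> itself, which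
  almost surely starts at \<open>0\<close>.
\<close>

lemma levy_char_weighted_increments:
  assumes L: "levy_process M L" and h: "h > 0"
  shows "char (distr M borel (\<lambda>\<omega>. \<Sum>k<n. a k * (L (real (Suc k) * h) \<omega> - L (real k * h) \<omega>))) z
    = (\<Prod>k<n. char (distr M borel (L h)) (a k * z))"
proof -
  interpret prob_space M using L by (simp add: levy_process_def)
  have "\<And>s. s \<ge> 0 \<Longrightarrow> L s \<in> borel_measurable M" using L by (simp add: levy_process_def)
  then have Lm: "L (real j * h) \<in> borel_measurable M" for j
    using h by simp
  define D where "D k \<omega> = L (real (Suc k) * h) \<omega> - L (real k * h) \<omega>" for k \<omega>
  have Dm: "D k \<in> borel_measurable M" for k
    unfolding D_def by (intro borel_measurable_diff Lm)
  have "indep_vars (\<lambda>_. borel) D {..<n}"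
    using levy_grid_increments(1)[OF L h, of n] by (simp add: D_def[abs_def])
  then have ind: "indep_vars (\<lambda>_. borel) (\<lambda>k \<omega>. a k * D k \<omega>) {..<n}"
    by (rule indep_vars_compose2[where Y = "\<lambda>k x. a k * x"]) simp
  have "char (distr M borel (\<lambda>\<omega>. a k * D k \<omega>)) z = char (distr M borel (L h)) (a k * z)" for k
    using char_distr_affine[OF Dm, of 0 "a k" k z] levy_grid_increments(2)[OF L h, of k]
    by (simp add: D_def[abs_def])
  then show ?thesis
    using char_distr_sum[OF ind, of z] by (simp add: D_def)
qed

lemma levy_char_multiple:
  assumes L: "levy_process M L" and h: "h > 0"
  shows "char (distr M borel (L (real k * h))) z = char (distr M borel (L h)) z ^ k"
proof -
  interpret prob_space M using L by (simp add: levy_process_def)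
  have m: "\<And>s. s \<ge> 0 \<Longrightarrow> L s \<in> borel_measurable M" using L by (simp add: levy_process_def)
  then have Lm: "L (real j * h) \<in> borel_measurable M" for j using h by simp
  have "distr M borel (L (real k * h))
      = distr M borel (\<lambda>\<omega>. \<Sum>j<k. 1 * (L (real (Suc j) * h) \<omega> - L (real j * h) \<omega>))"
  proof (rule distr_cong_AE)
    have "AE \<omega> in M. L 0 \<omega> = 0" using L by (simp add: levy_process_def)
    then show "AE \<omega> in M. L (real k * h) \<omega> = (\<Sum>j<k. 1 * (L (real (Suc j) * h) \<omega> - L (real j * h) \<omega>))"
    proof eventually_elim
      case (elim \<omega>)
      show ?case
        using sum_lessThan_telescope[of "\<lambda>j. L (real j * h) \<omega>" k] elim by simp
    qed
    show "(\<lambda>\<omega>. \<Sum>j<k. 1 * (L (real (Suc j) * h) \<omega> - L (real j * h) \<omega>)) \<in> borel_measurable M"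
      by (intro borel_measurable_sum borel_measurable_times borel_measurable_diff borel_measurable_const Lm)
  qed (simp_all add: Lm)
  then show ?thesis
    using levy_char_weighted_increments[OF L h, of "\<lambda>_. 1" k z] by simp
qed

text \<open>
  A characteristic function at time one determines the one at time \<open>1 / n\<close> only up to an \<open>n\<close>-th root of
  unity at each frequency. Continuity in the frequency makes this root constant, and it is \<open>1\<close> at
  frequency \<open>0\<close>.
\<close>

lemma continuous_root_of_exp_unique:
  fixes \<phi> :: "real \<Rightarrow> complex"
  assumes cont: "continuous_on UNIV \<phi>" and "\<phi> 0 = 1" and n: "n > 0"
    and pow: "\<And>z. \<phi> z ^ n = exp (- complex_of_real (c * z\<^sup>2))"
  shows "\<phi> z = exp (- complex_of_real (c * z\<^sup>2 / real n))"
proof -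
  define w where "w z = \<phi> z * exp (complex_of_real (c * z\<^sup>2 / real n))" for z
  have "w z ^ n = 1" for z
  proof -
    have "exp (complex_of_real (c * z\<^sup>2 / real n)) ^ n = exp (complex_of_real (c * z\<^sup>2))"
      using n by (simp add: exp_of_nat_mult[symmetric])
    then show ?thesis
      by (simp add: w_def power_mult_distrib pow exp_add[symmetric])
  qed
  then have "w ` UNIV \<subseteq> {u. u ^ n = 1}" by auto
  then have "finite (w ` UNIV)"
    by (rule finite_subset) (use n in \<open>simp add: finite_roots_unity\<close>)
  moreover have "continuous_on UNIV w"
    unfolding w_def by (intro continuous_intros cont) (use n in simp)
  ultimately have "w constant_on UNIV"
    by (intro continuous_finite_range_constant) simp_all
  moreover have "w 0 = 1" by (simp add: w_def \<open>\<phi> 0 = 1\<close>)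
  ultimately have "w z = 1" unfolding constant_on_def by (metis UNIV_I)
  then show ?thesis
    by (simp add: w_def exp_minus inverse_eq_divide nonzero_eq_divide_eq)
qed

text \<open>
  The formula holds at times \<open>1 / n\<close> by uniqueness of the continuous root and at their multiples by
  multiplicativity; every time \<open>s\<close> is a limit from the right of such multiples, and the paths are
  right-continuous.
\<close>

lemma levy_gaussian_char:
  assumes L: "levy_process M L" and s: "s \<ge> 0"
    and L1: "\<And>z. char (distr M borel (L 1)) z = exp (- complex_of_real (c * z\<^sup>2))"
  shows "char (distr M borel (L s)) z = exp (- complex_of_real (c * s * z\<^sup>2))"
proof -
  interpret prob_space M using L by (simp add: levy_process_def)
  have m [measurable]: "\<And>s. s \<ge> 0 \<Longrightarrow> L s \<in> borel_measurable M" using L by (simp add: levy_process_def)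
  have frac: "char (distr M borel (L (1 / real n))) z = exp (- complex_of_real (c * z\<^sup>2 / real n))"
    if n: "n > 0" for n z
  proof (rule continuous_root_of_exp_unique[OF _ _ n])
    interpret D: real_distribution "distr M borel (L (1 / real n))"
      using m by (intro real_distribution_distr) simp
    show "continuous_on UNIV (char (distr M borel (L (1 / real n))))"
      by (intro continuous_at_imp_continuous_on ballI D.isCont_char)
    show "char (distr M borel (L (1 / real n))) 0 = 1" by (rule D.char_zero)
    show "char (distr M borel (L (1 / real n))) z ^ n = exp (- complex_of_real (c * z\<^sup>2))" for z
      using levy_char_multiple[OF L, of "1 / real n" n z] L1[of z] n by simp
  qed
  define u where "u n = real (nat \<lceil>s * real n\<rceil>) * (1 / real n)" for n
  have u_char: "char (distr M borel (L (u n))) z = exp (- complex_of_real (c * u n * z\<^sup>2))" if "n > 0" for n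
  proof -
    have "char (distr M borel (L (u n))) z = exp (of_nat (nat \<lceil>s * real n\<rceil>) * - complex_of_real (c * z\<^sup>2 / real n))"
      unfolding u_def using levy_char_multiple[OF L, of "1 / real n"] frac[OF that] that
      by (simp only: exp_of_nat_mult) simp
    also have "of_nat (nat \<lceil>s * real n\<rceil>) * - complex_of_real (c * z\<^sup>2 / real n) = - complex_of_real (c * u n * z\<^sup>2)"
      by (simp add: u_def)
    finally show ?thesis .
  qed
  have u_bounds: "s \<le> u n" "u n \<le> s + 1 / real n" if "n > 0" for n
  proof -
    have "s * real n \<le> real (nat \<lceil>s * real n\<rceil>)" "real (nat \<lceil>s * real n\<rceil>) \<le> s * real n + 1"
      using s by (simp_all add: of_nat_nat)
    then show "s \<le> u n" "u n \<le> s + 1 / real n"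
      using that by (simp_all add: u_def pos_le_divide_eq divide_le_eq distrib_right)
  qed
  have u_lim: "u \<longlonglongrightarrow> s"
  proof (rule tendsto_sandwich)
    show "\<forall>\<^sub>F n in sequentially. s \<le> u n" "\<forall>\<^sub>F n in sequentially. u n \<le> s + 1 / real n"
      using eventually_gt_at_top[of 0] by (eventually_elim, simp add: u_bounds)+
    show "(\<lambda>n. s + 1 / real n) \<longlonglongrightarrow> s"
      using tendsto_add[OF tendsto_const lim_const_over_n[of 1]] by simp
  qed simp
  have "(\<lambda>n. char (distr M borel (L (u n))) z) \<longlonglongrightarrow> char (distr M borel (L s)) z"
  proof (rule char_tendsto_AE)
    show "L (u n) \<in> borel_measurable M" for n by (rule m) (simp add: u_def)
    show "L s \<in> borel_measurable M" by (rule m[OF s])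
    have "AE \<omega> in M. cadlag (\<lambda>t. L t \<omega>)" using L by (simp add: levy_process_def)
    then show "AE \<omega> in M. (\<lambda>n. L (u n) \<omega>) \<longlonglongrightarrow> L s \<omega>"
    proof eventually_elim
      case (elim \<omega>)
      have "\<forall>\<^sub>F n in sequentially. s \<le> u n"
        using eventually_gt_at_top[of 0] by eventually_elim (simp add: u_bounds)
      from cadlag_LIMSEQ_right[OF elim s u_lim this] show ?case .
    qed
  qed
  moreover have "(\<lambda>n. char (distr M borel (L (u n))) z) \<longlonglongrightarrow> exp (- complex_of_real (c * s * z\<^sup>2))"
  proof (rule Lim_transform_eventually)
    show "(\<lambda>n. exp (- complex_of_real (c * u n * z\<^sup>2))) \<longlonglongrightarrow> exp (- complex_of_real (c * s * z\<^sup>2))"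
      by (intro tendsto_intros u_lim)
    show "\<forall>\<^sub>F n in sequentially. exp (- complex_of_real (c * u n * z\<^sup>2)) = char (distr M borel (L (u n))) z"
      using eventually_gt_at_top[of 0] by eventually_elim (simp add: u_char)
  qed
  ultimately show ?thesis by (rule LIMSEQ_unique)
qed

lemma sum_powers_weighted:
  fixes p :: real
  shows "(1 - p) * (\<Sum>k<n. p ^ (n - k)) = p * (1 - p ^ n)"
proof (induction n)
  case (Suc n)
  have eq: "(\<Sum>k<Suc n. p ^ (Suc n - k)) = p ^ Suc n + (\<Sum>k<n. p ^ (n - k))"
    by (subst sum.lessThan_Suc_shift) simp
  then show ?case
    unfolding eq distrib_left Suc by (simp add: algebra_simps)
qed simp

text \<open>
  The Euler scheme has Gaussian characteristic function with mean \<open>q ^ n x0\<close> and variance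
  proportional to \<open>h (q\<^sup>2 + \<dots> + q ^ (2 n)) = (1 - q ^ (2 n)) / (2 lam + lam\<^sup>2 h)\<close>, because
  \<open>1 / q = 1 + lam h\<close>. As the grid is refined, \<open>q ^ n = (1 + lam t / n) ^ (- n)\<close> tends to
  \<open>exp (- lam t)\<close>.
\<close>

lemma OU_gaussian_char:
  assumes L: "levy_process M L" and X: "OU_strong_solution M L lam x0 X"
    and lam: "lam > 0" and t: "t > 0"
    and L1: "\<And>z. char (distr M borel (L 1)) z = exp (- complex_of_real (c * z\<^sup>2))"
    and Xm: "X t \<in> borel_measurable M"
  shows "char (distr M borel (X t)) z = iexp (z * (exp (- lam * t) * x0))
    * exp (- complex_of_real (c * ((1 - exp (- 2 * lam * t)) / (2 * lam)) * z\<^sup>2))"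
proof -
  interpret prob_space M using L by (simp add: levy_process_def)
  have m [measurable]: "\<And>s. s \<ge> 0 \<Longrightarrow> L s \<in> borel_measurable M" using L by (simp add: levy_process_def)
  define h where "h n = t / real n" for n
  define q where "q n = 1 / (1 + lam * (t / real n))" for n
  define S where "S n \<omega> = (\<Sum>k<n. q n ^ (n - k) * (L (real (Suc k) * h n) \<omega> - L (real k * h n) \<omega>))" for n \<omega>
  have h0: "0 \<le> h n" for n using t by (simp add: h_def)
  have [measurable]: "S n \<in> borel_measurable M" for n
    unfolding S_def using h0[of n]
    by (intro borel_measurable_sum borel_measurable_times borel_measurable_diff m borel_measurable_const) simp_all
  have AE: "AE \<omega> in M. (\<lambda>n. q n ^ n * x0 + 1 * S n \<omega>) \<longlonglongrightarrow> X t \<omega>"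
  proof -
    have "AE \<omega> in M. L 0 \<omega> = 0" using L by (simp add: levy_process_def)
    moreover have "AE \<omega> in M. cadlag (\<lambda>t. X t \<omega>)"
      "AE \<omega> in M. \<forall>t\<ge>0. X t \<omega> = x0 - lam * (LINT s:{0..t}|lborel. X s \<omega>) + L t \<omega>"
      using X by (simp_all add: OU_strong_solution_def)
    ultimately show ?thesis
    proof eventually_elim
      case (elim \<omega>)
      from implicit_euler_tendsto[OF elim(2) lam t elim(3)[rule_format] elim(1)]
      show ?case by (simp add: S_def q_def h_def)
    qed
  qed
  have lim: "(\<lambda>n. char (distr M borel (\<lambda>\<omega>. q n ^ n * x0 + 1 * S n \<omega>)) z) \<longlonglongrightarrow> char (distr M borel (X t)) z"
    by (rule char_tendsto_AE[OF _ Xm AE]) simp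
  have q_lim: "(\<lambda>n. q n ^ n) \<longlonglongrightarrow> exp (- lam * t)"
  proof -
    have "(\<lambda>n. inverse ((1 + lam * t / real n) ^ n)) \<longlonglongrightarrow> inverse (exp (lam * t))"
      by (intro tendsto_inverse tendsto_exp_limit_sequentially) simp
    then show ?thesis
      by (simp add: q_def exp_minus inverse_eq_divide power_one_over)
  qed
  have approx: "char (distr M borel (\<lambda>\<omega>. q n ^ n * x0 + 1 * S n \<omega>)) z
      = iexp (z * (q n ^ n * x0)) * exp (- complex_of_real (c * ((1 - (q n ^ n)\<^sup>2) / (2 * lam + lam\<^sup>2 * h n)) * z\<^sup>2))"
    if n: "n > 0" for n
  proof -
    have h: "0 < h n" using t n by (simp add: h_def)
    have q0: "0 < 1 + lam * h n" using lam h by (simp add: add_pos_pos)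
    have var: "h n * (\<Sum>k<n. (q n ^ (n - k))\<^sup>2) = (1 - (q n ^ n)\<^sup>2) / (2 * lam + lam\<^sup>2 * h n)"
    proof -
      define p where "p = (q n)\<^sup>2"
      have pow: "(q n ^ j)\<^sup>2 = p ^ j" for j
        by (simp add: p_def power_mult[symmetric] mult.commute)
      have p: "p * (1 + lam * h n)\<^sup>2 = 1"
        using q0 by (simp add: p_def q_def h_def power_divide)
      then have p0: "p \<noteq> 0" by auto
      have "1 - p = p * ((1 + lam * h n)\<^sup>2 - 1)" using p by (simp add: algebra_simps)
      also have "\<dots> = p * (h n * (2 * lam + lam\<^sup>2 * h n))"
        by (simp add: power2_eq_square algebra_simps)
      finally have 1: "1 - p = p * (h n * (2 * lam + lam\<^sup>2 * h n))" .
      have "p * (h n * (2 * lam + lam\<^sup>2 * h n)) * (\<Sum>k<n. p ^ (n - k)) = p * (1 - p ^ n)"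
        using sum_powers_weighted[of p n] unfolding 1 .
      then have "h n * (\<Sum>k<n. p ^ (n - k)) * (2 * lam + lam\<^sup>2 * h n) = 1 - p ^ n"
        using p0 by (simp add: mult_ac)
      moreover have "2 * lam + lam\<^sup>2 * h n \<noteq> 0"
        using lam h by (intro less_imp_neq[symmetric] add_pos_pos) simp_all
      ultimately show ?thesis
        unfolding pow by (simp add: nonzero_eq_divide_eq)
    qed
    have "char (distr M borel (S n)) z = (\<Prod>k<n. char (distr M borel (L (h n))) (q n ^ (n - k) * z))"
      unfolding S_def by (rule levy_char_weighted_increments[OF L h])
    also have "\<dots> = (\<Prod>k<n. exp (- complex_of_real (c * h n * (q n ^ (n - k) * z)\<^sup>2)))"
      using levy_gaussian_char[OF L less_imp_le[OF h] L1] by simp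
    also have "\<dots> = exp (\<Sum>k<n. - complex_of_real (c * h n * (q n ^ (n - k) * z)\<^sup>2))"
      by (rule exp_sum[symmetric]) simp
    also have "(\<Sum>k<n. - complex_of_real (c * h n * (q n ^ (n - k) * z)\<^sup>2))
        = - complex_of_real (c * (h n * (\<Sum>k<n. (q n ^ (n - k))\<^sup>2)) * z\<^sup>2)"
      unfolding sum_negf of_real_sum[symmetric]
      by (simp add: sum_distrib_left sum_distrib_right power_mult_distrib mult_ac)
    finally have "char (distr M borel (S n)) z = exp (- complex_of_real (c * ((1 - (q n ^ n)\<^sup>2) / (2 * lam + lam\<^sup>2 * h n)) * z\<^sup>2))"
      unfolding var .
    then show ?thesis
      using char_distr_affine[of "S n" "q n ^ n * x0" 1 z] by simp
  qed
  have "(\<lambda>n. iexp (z * (q n ^ n * x0)) * exp (- complex_of_real (c * ((1 - (q n ^ n)\<^sup>2) / (2 * lam + lam\<^sup>2 * h n)) * z\<^sup>2)))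
     \<longlonglongrightarrow> iexp (z * (exp (- lam * t) * x0)) * exp (- complex_of_real (c * ((1 - (exp (- lam * t))\<^sup>2) / (2 * lam + lam\<^sup>2 * 0)) * z\<^sup>2))"
    using lam unfolding h_def by (intro tendsto_intros q_lim lim_const_over_n) simp
  then have conv: "(\<lambda>n. char (distr M borel (\<lambda>\<omega>. q n ^ n * x0 + 1 * S n \<omega>)) z) \<longlonglongrightarrow>
      iexp (z * (exp (- lam * t) * x0)) * exp (- complex_of_real (c * ((1 - (exp (- lam * t))\<^sup>2) / (2 * lam + lam\<^sup>2 * 0)) * z\<^sup>2))"
    by (rule Lim_transform_eventually)
      (use eventually_gt_at_top[of 0] in \<open>eventually_elim, simp only: approx\<close>)
  have sq: "(exp (- lam * t))\<^sup>2 = exp (- 2 * lam * t)"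
    by (simp add: power2_eq_square exp_add[symmetric])
  show ?thesis
    using LIMSEQ_unique[OF lim conv] unfolding sq by simp
qed

text \<open>
  Every generator of the augmented filtration is an event of the underlying space, so an adapted
  solution consists of random variables.
\<close>

lemma augmented_filtration_measurable:
  fixes f :: "'a \<Rightarrow> real"
  assumes L: "levy_process M L" and "t \<ge> 0" and f: "f \<in> borel_measurable (augmented_filtration M L t)"
  shows "f \<in> borel_measurable M"
proof -
  have m: "\<And>s. s \<ge> 0 \<Longrightarrow> L s \<in> borel_measurable M" using L by (simp add: levy_process_def)
  let ?G = "(\<Union>s\<in>{0..t}. {L s -` A \<inter> space M | A. A \<in> sets borel}) \<union> null_sets M"
  have G: "?G \<subseteq> sets M"
  proof
    fix B assume "B \<in> ?G"
    then consider s A where "s \<in> {0..t}" "A \<in> sets borel" "B = L s -` A \<inter> space M" | "B \<in> null_sets M"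
      by blast
    then show "B \<in> sets M"
    proof cases
      case 1
      then show ?thesis using measurable_sets[OF m[of s], of A] by simp
    qed auto
  qed
  then have Pow: "?G \<subseteq> Pow (space M)" using sets.space_closed by (rule subset_trans)
  have sets: "sets (augmented_filtration M L t) \<subseteq> sets M"
    unfolding augmented_filtration_def sets_measure_of[OF Pow] using G by (rule sets.sigma_sets_subset)
  have space: "space (augmented_filtration M L t) = space M"
    unfolding augmented_filtration_def using Pow by (rule space_measure_of)
  show ?thesis
  proof (rule measurableI)
    fix A :: "real set" assume "A \<in> sets borel"
    from measurable_sets[OF f this] show "f -` A \<inter> space M \<in> sets M"
      using sets unfolding space by (rule subsetD[rotated])
  qed simp
qed

section \<open>The cut-off profile\<close>

lemma OU_cdf:
  assumes L: "levy_process M L" and X: "OU_strong_solution M L lam x0 X"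
    and lam: "lam > 0" and c: "c > 0" and t: "t > 0"
    and L1: "\<And>z. char (distr M borel (L 1)) z = exp (- complex_of_real (c * z\<^sup>2))"
  shows "cdf (distr M borel (X t)) x
    = \<Phi> ((x - exp (- lam * t) * x0) / (sqrt (c / lam) * sqrt (1 - exp (- 2 * lam * t))))"
proof -
  interpret prob_space M using L by (simp add: levy_process_def)
  have Xm [measurable]: "X t \<in> borel_measurable M"
    by (rule augmented_filtration_measurable[OF L less_imp_le[OF t]])
       (use X t in \<open>simp add: OU_strong_solution_def\<close>)
  define \<sigma> where "\<sigma> = sqrt (c / lam) * sqrt (1 - exp (- 2 * lam * t))"
  have pos: "0 < 1 - exp (- 2 * lam * t)" using lam t by simp
  then have "\<sigma> > 0" using lam c unfolding \<sigma>_def by (intro mult_pos_pos) simp_all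
  have sq: "(\<sigma> * z)\<^sup>2 / 2 = c * ((1 - exp (- 2 * lam * t)) / (2 * lam)) * z\<^sup>2" for z
  proof -
    have "\<sigma>\<^sup>2 = c / lam * (1 - exp (- 2 * lam * t))"
      using pos lam c unfolding \<sigma>_def power_mult_distrib by simp
    then show ?thesis by (simp add: power_mult_distrib)
  qed
  have "\<P>(\<omega> in M. X t \<omega> \<le> x) = \<Phi> ((x - exp (- lam * t) * x0) / \<sigma>)"
    by (rule gaussian_cdf_of_char[OF Xm \<open>\<sigma> > 0\<close>])
       (unfold sq, rule OU_gaussian_char[OF L X lam t L1 Xm])
  then show ?thesis
    by (simp add: cdf_def2 measure_distr vimage_def Int_def conj_commute \<sigma>_def)
qed

lemma OU_limit_cdf:
  assumes "prob_space M" and [measurable]: "Y \<in> borel_measurable M" and lam: "lam > 0" and c: "c > 0"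
    and Y: "\<And>z. char (distr M borel Y) z = exp (- complex_of_real (c * z\<^sup>2))"
  shows "cdf (distr M borel (\<lambda>\<omega>. (1 / (lam * 2)) powr (1 / 2) * Y \<omega>)) x = \<Phi> (x / sqrt (c / lam))"
proof -
  interpret prob_space M by fact
  define a where "a = sqrt (1 / (lam * 2))"
  have a: "(1 / (lam * 2)) powr (1 / 2) = a"
    using lam unfolding a_def by (simp add: powr_half_sqrt)
  have var: "c * (a * z)\<^sup>2 = (sqrt (c / lam) * z)\<^sup>2 / 2" for z
    using lam c by (simp add: a_def power_mult_distrib)
  have "char (distr M borel (\<lambda>\<omega>. a * Y \<omega>)) z
      = iexp (z * 0) * exp (- complex_of_real ((sqrt (c / lam) * z)\<^sup>2 / 2))" for z
    using char_distr_affine[of Y 0 a z] Y[of "a * z"] unfolding var by simp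
  then have "\<P>(\<omega> in M. a * Y \<omega> \<le> x) = \<Phi> ((x - 0) / sqrt (c / lam))"
    by (intro gaussian_cdf_of_char) (use lam c in simp_all)
  then show ?thesis
    unfolding a by (simp add: cdf_def2 measure_distr vimage_def Int_def conj_commute)
qed

lemma iid_max_measurable:
  fixes g :: "'s \<Rightarrow> real"
  assumes iid: "iid_with_law N S \<mu> Y" and g: "g \<in> borel_measurable S"
  shows "(\<lambda>\<omega>. MAX j\<in>{1..n}. g (Y j \<omega>)) \<in> borel_measurable N"
proof -
  interpret prob_space N using iid by (simp add: iid_with_law_def)
  have "Y j \<in> measurable N S" if "j \<ge> 1" for j
    using iid that unfolding iid_with_law_def indep_vars_def by auto
  then have "(\<lambda>\<omega>. g (Y j \<omega>)) \<in> borel_measurable N" if "j \<in> {1..n}" for j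
    using measurable_compose[OF _ g] that by auto
  then show ?thesis by (intro borel_measurable_Max) auto
qed

text \<open>
  The variables take values in an arbitrary space and are observed through \<open>g\<close>, so that the lemma applies
  both to real variables and to whole paths evaluated at a fixed time.
\<close>

lemma iid_max_cdf:
  fixes g :: "'s \<Rightarrow> real"
  assumes iid: "iid_with_law N S \<mu> Y" and g: "g \<in> borel_measurable S" and n: "n > 0"
  shows "\<P>(\<omega> in N. (MAX j\<in>{1..n}. g (Y j \<omega>)) \<le> x) = cdf (distr \<mu> borel g) x ^ n"
proof -
  interpret prob_space N using iid by (simp add: iid_with_law_def)
  have ind: "indep_vars (\<lambda>_. S) Y {1..}" and law: "\<And>j. j \<ge> 1 \<Longrightarrow> distr N S (Y j) = \<mu>"
    using iid by (auto simp: iid_with_law_def)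
  have Ym: "Y j \<in> measurable N S" if "j \<ge> 1" for j
    using ind that unfolding indep_vars_def by auto
  have ind_g: "indep_vars (\<lambda>_. borel) (\<lambda>j \<omega>. g (Y j \<omega>)) {1..}"
    by (rule indep_vars_compose2[OF ind]) (rule g)
  have one: "prob ((\<lambda>\<omega>. g (Y j \<omega>)) -` {..x} \<inter> space N) = cdf (distr \<mu> borel g) x" if "j \<ge> 1" for j
  proof -
    have "distr \<mu> borel g = distr N borel (\<lambda>\<omega>. g (Y j \<omega>))"
      unfolding law[OF that, symmetric] by (subst distr_distr[OF g Ym[OF that]]) (simp add: comp_def)
    then show ?thesis
      using measurable_compose[OF Ym[OF that] g] by (simp add: cdf_def2 measure_distr)
  qed
  have "{\<omega> \<in> space N. (MAX j\<in>{1..n}. g (Y j \<omega>)) \<le> x} = (\<Inter>j\<in>{1..n}. (\<lambda>\<omega>. g (Y j \<omega>)) -` {..x} \<inter> space N)"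
    using n by (subst Max_le_iff) (auto simp: Suc_le_eq)
  also have "prob \<dots> = (\<Prod>j\<in>{1..n}. prob ((\<lambda>\<omega>. g (Y j \<omega>)) -` {..x} \<inter> space N))"
    by (rule indep_varsD[OF ind_g]) (use n in auto)
  also have "\<dots> = (\<Prod>j\<in>{1..n}. cdf (distr \<mu> borel g) x)"
    by (rule prod.cong) (simp_all add: one)
  finally show ?thesis by simp
qed

lemma path_eval_measurable: "s \<ge> 0 \<Longrightarrow> (\<lambda>f. f s) \<in> borel_measurable path_space"
  by (rule measurable_component_singleton) simp

lemma process_copies_max_cdf:
  assumes copies: "iid_process_copies M X N Xs" and Xm: "\<And>u. u \<ge> 0 \<Longrightarrow> X u \<in> borel_measurable M"
    and s: "s \<ge> 0"
  shows "(\<lambda>\<omega>. MAX j\<in>{1..n}. Xs j s \<omega>) \<in> borel_measurable N"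
    and "n > 0 \<Longrightarrow> \<P>(\<omega> in N. (MAX j\<in>{1..n}. Xs j s \<omega>) \<le> x) = cdf (distr M borel (X s)) x ^ n"
proof -
  note iid = copies[unfolded iid_process_copies_def]
  have eval: "path (Xs j) \<omega> s = Xs j s \<omega>" for j \<omega> using s by (simp add: path_def)
  have "path X = (\<lambda>\<omega>. \<lambda>u\<in>{0..}. X u \<omega>)" by (simp add: path_def fun_eq_iff)
  then have pathm: "path X \<in> measurable M path_space"
    using Xm by (auto intro!: measurable_restrict)
  have "distr (distr M path_space (path X)) borel (\<lambda>f. f s) = distr M borel (X s)"
    using s by (subst distr_distr[OF path_eval_measurable pathm]) (simp_all add: comp_def path_def)
  then show "n > 0 \<Longrightarrow> \<P>(\<omega> in N. (MAX j\<in>{1..n}. Xs j s \<omega>) \<le> x) = cdf (distr M borel (X s)) x ^ n"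
    using iid_max_cdf[OF iid path_eval_measurable[OF s], of n x] unfolding eval by simp
  show "(\<lambda>\<omega>. MAX j\<in>{1..n}. Xs j s \<omega>) \<in> borel_measurable N"
    using iid_max_measurable[OF iid path_eval_measurable[OF s], of n] unfolding eval .
qed

text \<open>
  The choice of the cut-off time gives \<open>exp (- lam T) = exp (- lam b w) / sqrt (ln n)\<close>, which compensates
  the center \<open>sqrt (2 ln n)\<close> in the mean term. For the scale term,
  \<open>1 - r = (1 - r\<^sup>2) / (1 + r) = exp (- 2 lam T) / (1 + r)\<close>, whose order \<open>1 / ln n\<close> compensates the square of
  the center.
\<close>

lemma cutoff_location:
  fixes w :: "nat \<Rightarrow> real"
  assumes lam: "lam > 0" and c: "c > 0" and w: "w \<longlonglongrightarrow> \<kappa>"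
    and T: "\<And>n. T n = 1 / (2 * lam) * ln (ln (real n)) + b * w n"
  defines "r \<equiv> \<lambda>n. sqrt (1 - exp (- 2 * lam * T n))"
  shows "filterlim T at_top sequentially" and "r \<longlonglongrightarrow> 1"
    and "(\<lambda>n. gauss_max_center n * (exp (- lam * T n) * x0 / sqrt (c / lam)) - (1 - r n) * (gauss_max_center n)\<^sup>2)
      \<longlonglongrightarrow> (2 * lam / c) powr (1 / 2) * exp (- lam * \<kappa> * b) * x0 - exp (- 2 * lam * \<kappa> * b)"
proof -
  have lnln: "filterlim (\<lambda>n. ln (ln (real n))) at_top sequentially" by real_asymp
  have base: "filterlim (\<lambda>n. 1 / (2 * lam) * ln (ln (real n))) at_top sequentially"
    by (rule filterlim_tendsto_pos_mult_at_top[OF tendsto_const _ lnln]) (use lam in simp)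
  have bw: "(\<lambda>n. b * w n) \<longlonglongrightarrow> b * \<kappa>" by (intro tendsto_intros w)
  have "T = (\<lambda>n. b * w n + 1 / (2 * lam) * ln (ln (real n)))"
    by (simp add: T fun_eq_iff)
  then show T_top: "filterlim T at_top sequentially"
    using filterlim_tendsto_add_at_top[OF bw base] by (simp only:)
  have e: "(\<lambda>n. exp (- 2 * lam * T n)) \<longlonglongrightarrow> 0"
  proof -
    have "filterlim (\<lambda>n. 2 * lam * T n) at_top sequentially"
      by (rule filterlim_tendsto_pos_mult_at_top[OF tendsto_const _ T_top]) (use lam in simp)
    then have "filterlim (\<lambda>n. - (2 * lam * T n)) at_bot sequentially"
      by (simp add: filterlim_uminus_at_top)
    from filterlim_compose[OF exp_at_bot this] show ?thesis by simp
  qed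
  have "(\<lambda>n. sqrt (1 - exp (- 2 * lam * T n))) \<longlonglongrightarrow> sqrt (1 - 0)"
    by (intro tendsto_intros e)
  then show r_lim: "r \<longlonglongrightarrow> 1" by (simp add: r_def)
  have L_pos: "\<forall>\<^sub>F n in sequentially. 0 < ln (real n)"
    using eventually_gt_at_top[of 1] by eventually_elim simp
  have sq_ratio: "(\<lambda>n. (gauss_max_center n)\<^sup>2 / ln (real n)) \<longlonglongrightarrow> 2"
  proof (rule Lim_transform_eventually)
    show "(\<lambda>n. (2 * ln (real n) - ln (4 * pi * ln (real n))) / ln (real n)) \<longlonglongrightarrow> 2" by real_asymp
    show "\<forall>\<^sub>F n in sequentially. (2 * ln (real n) - ln (4 * pi * ln (real n))) / ln (real n)
        = (gauss_max_center n)\<^sup>2 / ln (real n)"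
      using gauss_max_center_sq by eventually_elim simp
  qed
  have center_pos: "\<forall>\<^sub>F n in sequentially. 0 < gauss_max_center n"
    using gauss_max_center_at_top by (simp add: filterlim_at_top_dense)
  have ratio: "(\<lambda>n. gauss_max_center n / sqrt (ln (real n))) \<longlonglongrightarrow> sqrt 2"
  proof (rule Lim_transform_eventually[OF tendsto_real_sqrt[OF sq_ratio]])
    show "\<forall>\<^sub>F n in sequentially. sqrt ((gauss_max_center n)\<^sup>2 / ln (real n)) = gauss_max_center n / sqrt (ln (real n))"
      using center_pos by eventually_elim (simp add: real_sqrt_divide)
  qed
  have decay: "exp (- lam * T n) = exp (- lam * (b * w n)) / sqrt (ln (real n))" if "0 < ln (real n)" for n
  proof -
    have "- lam * T n = - lam * (b * w n) - ln (sqrt (ln (real n)))"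
      using lam that by (simp add: T ln_sqrt distrib_left)
    then show ?thesis using that by (simp only: exp_diff) simp
  qed
  have mean: "(\<lambda>n. gauss_max_center n * (exp (- lam * T n) * x0 / sqrt (c / lam)))
      \<longlonglongrightarrow> sqrt 2 * exp (- lam * (b * \<kappa>)) * (x0 / sqrt (c / lam))"
  proof (rule Lim_transform_eventually)
    show "(\<lambda>n. gauss_max_center n / sqrt (ln (real n)) * exp (- lam * (b * w n)) * (x0 / sqrt (c / lam)))
        \<longlonglongrightarrow> sqrt 2 * exp (- lam * (b * \<kappa>)) * (x0 / sqrt (c / lam))"
      by (intro tendsto_mult[OF _ tendsto_const] tendsto_mult[OF ratio] tendsto_exp tendsto_mult[OF tendsto_const] bw)
    show "\<forall>\<^sub>F n in sequentially. gauss_max_center n / sqrt (ln (real n)) * exp (- lam * (b * w n)) * (x0 / sqrt (c / lam))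
        = gauss_max_center n * (exp (- lam * T n) * x0 / sqrt (c / lam))"
      using L_pos by eventually_elim (simp only: decay, simp)
  qed
  have scale: "(\<lambda>n. (1 - r n) * (gauss_max_center n)\<^sup>2) \<longlonglongrightarrow> exp (- 2 * lam * (b * \<kappa>)) * 2 / (1 + 1)"
  proof (rule Lim_transform_eventually)
    show "(\<lambda>n. exp (- 2 * lam * (b * w n)) * ((gauss_max_center n)\<^sup>2 / ln (real n)) / (1 + r n))
        \<longlonglongrightarrow> exp (- 2 * lam * (b * \<kappa>)) * 2 / (1 + 1)"
      by (intro tendsto_divide tendsto_add tendsto_const r_lim tendsto_mult[OF _ sq_ratio] tendsto_exp
          tendsto_mult[OF tendsto_const] bw) simp
    have T_pos: "\<forall>\<^sub>F n in sequentially. 0 < T n"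
      using T_top by (simp add: filterlim_at_top_dense)
    show "\<forall>\<^sub>F n in sequentially. exp (- 2 * lam * (b * w n)) * ((gauss_max_center n)\<^sup>2 / ln (real n)) / (1 + r n)
        = (1 - r n) * (gauss_max_center n)\<^sup>2"
      using L_pos T_pos
    proof eventually_elim
      case (elim n)
      have "exp (- 2 * lam * T n) = (exp (- lam * T n))\<^sup>2"
        by (simp add: power2_eq_square exp_add[symmetric])
      also have "\<dots> = (exp (- lam * (b * w n)))\<^sup>2 / ln (real n)"
        using elim(1) by (simp only: decay[OF elim(1)] power_divide) simp
      also have "(exp (- lam * (b * w n)))\<^sup>2 = exp (- 2 * lam * (b * w n))"
        by (simp add: power2_eq_square exp_add[symmetric])
      finally have decay2: "exp (- 2 * lam * T n) = exp (- 2 * lam * (b * w n)) / ln (real n)" .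
      have "0 \<le> 1 - exp (- 2 * lam * T n)" using lam elim(2) by simp
      then have r: "0 \<le> r n" "(r n)\<^sup>2 = 1 - exp (- 2 * lam * T n)"
        by (simp_all only: r_def real_sqrt_ge_zero real_sqrt_pow2)
      have "(1 - r n) * (1 + r n) = exp (- 2 * lam * T n)"
        using r(2) by (simp add: algebra_simps power2_eq_square)
      then have "1 - r n = exp (- 2 * lam * T n) / (1 + r n)"
        using r(1) by (simp add: nonzero_eq_divide_eq)
      then show ?case unfolding decay2 by simp
    qed
  qed
  have const: "sqrt 2 * exp (- lam * (b * \<kappa>)) * (x0 / sqrt (c / lam)) - exp (- 2 * lam * (b * \<kappa>)) * 2 / (1 + 1)
      = (2 * lam / c) powr (1 / 2) * exp (- lam * \<kappa> * b) * x0 - exp (- 2 * lam * \<kappa> * b)"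
  proof -
    have "(2 * lam / c) powr (1 / 2) = sqrt 2 / sqrt (c / lam)"
      using lam c by (simp add: powr_half_sqrt real_sqrt_divide real_sqrt_mult)
    then show ?thesis by (simp add: mult_ac)
  qed
  show "(\<lambda>n. gauss_max_center n * (exp (- lam * T n) * x0 / sqrt (c / lam)) - (1 - r n) * (gauss_max_center n)\<^sup>2)
      \<longlonglongrightarrow> (2 * lam / c) powr (1 / 2) * exp (- lam * \<kappa> * b) * x0 - exp (- 2 * lam * \<kappa> * b)"
    using tendsto_diff[OF mean scale] unfolding const .
qed

text \<open>
  In terms of \<open>u = exp (- lam \<kappa> b)\<close>, which tends to infinity, the shift is \<open>(a x0 - u) u\<close>: the
  quadratic term from the scale always beats the linear term from the initial value.
\<close>

lemma profile_at_bot: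
  assumes G: "gumbel_distributed P \<xi>" and "lam > 0" "\<kappa> > 0"
  shows "((\<lambda>b. tv_dist P (\<lambda>\<omega>. a * exp (- lam * \<kappa> * b) * x0 - exp (- 2 * lam * \<kappa> * b) + \<xi> \<omega>) P \<xi>) \<longlongrightarrow> 1) at_bot"
proof -
  have quad: "filterlim (\<lambda>u::real. (a * x0 - u) * u) at_bot at_top"
  proof -
    have "filterlim (\<lambda>u::real. (u + - (a * x0)) * u) at_top at_top"
      by (intro filterlim_at_top_mult_at_top filterlim_ident)
        (use filterlim_tendsto_add_at_top[OF tendsto_const[of "- (a * x0)"] filterlim_ident]
          in \<open>simp add: add.commute\<close>)
    then have "filterlim (\<lambda>u::real. - ((u + - (a * x0)) * u)) at_bot at_top"
      by (simp add: filterlim_uminus_at_top)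
    moreover have "- ((u + - (a * x0)) * u) = (a * x0 - u) * u" for u by (simp add: algebra_simps)
    ultimately show ?thesis by simp
  qed
  have "filterlim (\<lambda>b. exp (- lam * \<kappa> * b)) at_top at_bot"
    using assms(2,3) by real_asymp
  from filterlim_compose[OF quad this]
  have "filterlim (\<lambda>b. a * exp (- lam * \<kappa> * b) * x0 - exp (- 2 * lam * \<kappa> * b)) at_bot at_bot"
  proof -
    have "exp (- 2 * lam * \<kappa> * b) = exp (- lam * \<kappa> * b) * exp (- lam * \<kappa> * b)" for b
      by (simp add: exp_add[symmetric])
    with \<open>filterlim (\<lambda>b. (a * x0 - exp (- lam * \<kappa> * b)) * exp (- lam * \<kappa> * b)) at_bot at_bot\<close>
    show ?thesis by (simp add: algebra_simps)
  qed
  from filterlim_compose[OF tv_dist_gumbel_shift_at_bot[OF G] this] show ?thesis .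
qed

lemma profile_at_top:
  assumes G: "gumbel_distributed P \<xi>" and "lam > 0" "\<kappa> > 0"
  shows "((\<lambda>b. tv_dist P (\<lambda>\<omega>. a * exp (- lam * \<kappa> * b) * x0 - exp (- 2 * lam * \<kappa> * b) + \<xi> \<omega>) P \<xi>) \<longlongrightarrow> 0) at_top"
proof (rule tendsto_at_topI_sequentially)
  fix B :: "nat \<Rightarrow> real" assume B: "filterlim B at_top sequentially"
  have e: "(\<lambda>n. exp (- k * B n)) \<longlonglongrightarrow> 0" if "k > 0" for k
  proof -
    have "filterlim (\<lambda>n. k * B n) at_top sequentially"
      by (rule filterlim_tendsto_pos_mult_at_top[OF tendsto_const that B])
    then have "filterlim (\<lambda>n. - (k * B n)) at_bot sequentially"
      by (simp add: filterlim_uminus_at_top)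
    from filterlim_compose[OF exp_at_bot this] show ?thesis by simp
  qed
  have "(\<lambda>n. a * exp (- (lam * \<kappa>) * B n) * x0 - exp (- (2 * lam * \<kappa>) * B n)) \<longlonglongrightarrow> a * 0 * x0 - 0"
    using assms(2,3) by (intro tendsto_diff tendsto_mult tendsto_const e) simp_all
  then have "(\<lambda>n. a * exp (- lam * \<kappa> * B n) * x0 - exp (- 2 * lam * \<kappa> * B n)) \<longlonglongrightarrow> 0" by simp
  from tv_dist_gumbel_shift_tendsto_0[OF G this]
  show "(\<lambda>n. tv_dist P (\<lambda>\<omega>. a * exp (- lam * \<kappa> * B n) * x0 - exp (- 2 * lam * \<kappa> * B n) + \<xi> \<omega>) P \<xi>) \<longlonglongrightarrow> 0"
    by (simp add: add.commute)
qed

theorem theorem1p2: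
  fixes lam c \<alpha> x0 \<kappa> :: real
    and M :: "'a measure" and L X :: "real \<Rightarrow> 'a \<Rightarrow> real"
    and N :: "'b measure" and Xs :: "nat \<Rightarrow> real \<Rightarrow> 'b \<Rightarrow> real"
    and N' :: "'d measure" and Xinf :: "nat \<Rightarrow> 'd \<Rightarrow> real"
    and Z :: "nat \<Rightarrow> real \<Rightarrow> 'b \<Rightarrow> real" and Zinf :: "nat \<Rightarrow> 'd \<Rightarrow> real"
    and P :: "'p measure" and \<xi> :: "'p \<Rightarrow> real"
    and t w \<epsilon> :: "nat \<Rightarrow> real" and G :: "real \<Rightarrow> real"
  assumes "lam > 0" and "c > 0" and "\<alpha> \<in> {0<..2}"
    and "levy_process M L"
    and "\<And>z. char (distr M borel (L 1)) z = exp (- complex_of_real (c * \<bar>z\<bar> powr \<alpha>))"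
    and "OU_strong_solution M L lam x0 X"
    and "iid_process_copies M X N Xs"
    and "iid_with_law N' borel
           (distr M borel (\<lambda>\<omega>. (1 / (lam * \<alpha>)) powr (1 / \<alpha>) * L 1 \<omega>)) Xinf"
    and "\<And>n s \<omega>. Z n s \<omega> = (MAX j\<in>{1..n}. Xs j s \<omega>)"
    and "\<And>n \<omega>. Zinf n \<omega> = (MAX j\<in>{1..n}. Xinf j \<omega>)"
    and "gumbel_distributed P \<xi>"
    and "\<alpha> = 2"
    and "\<kappa> > 0" and "\<epsilon> \<longlonglongrightarrow> 0"
    and "\<And>n. t n = 1 / (2 * lam) * ln (ln (real n))"
    and "\<And>n. w n = \<kappa> + \<epsilon> n"
    and "\<And>b. G b = tv_dist
           P (\<lambda>\<omega>. (2 * lam / c) powr (1 / 2) * exp (- lam * \<kappa> * b) * x0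
                    - exp (- 2 * lam * \<kappa> * b) + \<xi> \<omega>)
           P \<xi>"
  shows "profile_cutoff N Z N' Zinf t w G \<and>
         (\<forall>b. (\<lambda>n. tv_dist N (Z n (t n + b * w n)) N' (Zinf n)) \<longlonglongrightarrow> G b) \<and>
         (G \<longlongrightarrow> 1) at_bot \<and> (G \<longlongrightarrow> 0) at_top"
proof -
  have \<alpha>: "\<alpha> = 2" by fact
  note lam = \<open>lam > 0\<close> and c = \<open>c > 0\<close> and L = \<open>levy_process M L\<close>
    and X = \<open>OU_strong_solution M L lam x0 X\<close> and copies = \<open>iid_process_copies M X N Xs\<close>
    and gumbel = \<open>gumbel_distributed P \<xi>\<close>
  note iid_inf = assms(8)[unfolded \<alpha>]
  have t: "t n = 1 / (2 * lam) * ln (ln (real n))" and w: "w n = \<kappa> + \<epsilon> n" for n by fact+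
  have Z: "Z n s \<omega> = (MAX j\<in>{1..n}. Xs j s \<omega>)" and Zinf: "Zinf n \<omega>' = (MAX j\<in>{1..n}. Xinf j \<omega>')" for n s \<omega> \<omega>'
    by fact+
  have G: "G b = tv_dist P (\<lambda>\<omega>. (2 * lam / c) powr (1 / 2) * exp (- lam * \<kappa> * b) * x0
                    - exp (- 2 * lam * \<kappa> * b) + \<xi> \<omega>) P \<xi>" for b
    by fact
  have prob_M: "prob_space M" and Lm: "\<And>s. s \<ge> 0 \<Longrightarrow> L s \<in> borel_measurable M"
    using L by (simp_all add: levy_process_def)
  have prob_N: "prob_space N" using copies by (simp add: iid_process_copies_def iid_with_law_def)
  have prob_N': "prob_space N'" using iid_inf by (simp add: iid_with_law_def)
  have prob_P: "prob_space P" using gumbel by (simp add: gumbel_distributed_def)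
  have L1: "char (distr M borel (L 1)) z = exp (- complex_of_real (c * z\<^sup>2))" for z
  proof -
    have "\<bar>z\<bar> powr 2 = z\<^sup>2"
      by (cases "z = 0") (simp_all add: powr_numeral)
    then show ?thesis using assms(5)[of z] by (simp only: \<alpha>)
  qed
  define \<sigma> where "\<sigma> = sqrt (c / lam)"
  have \<sigma>: "\<sigma> > 0" using lam c by (simp add: \<sigma>_def)
  have w_lim: "w \<longlonglongrightarrow> \<kappa>"
    using tendsto_add[OF tendsto_const \<open>\<epsilon> \<longlonglongrightarrow> 0\<close>, of \<kappa>] by (simp add: w[abs_def])
  have t_top: "filterlim t at_top sequentially"
    using cutoff_location(1)[OF lam c w_lim, of t 0] t by simp
  have cutoff: "(\<lambda>n. tv_dist N (Z n (t n + b * w n)) N' (Zinf n)) \<longlonglongrightarrow> G b" for b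
  proof -
    define T where "T n = t n + b * w n" for n
    define r where "r n = sqrt (1 - exp (- 2 * lam * T n))" for n
    define m where "m n = exp (- lam * T n) * x0 / \<sigma>" for n
    define s where "s = (2 * lam / c) powr (1 / 2) * exp (- lam * \<kappa> * b) * x0 - exp (- 2 * lam * \<kappa> * b)"
    let ?b = gauss_max_center
    have T: "T n = 1 / (2 * lam) * ln (ln (real n)) + b * w n" for n
      by (simp add: T_def t)
    note T_top = cutoff_location(1)[OF lam c w_lim T]
    have r_lim: "r \<longlonglongrightarrow> 1"
      unfolding r_def[abs_def] by (rule cutoff_location(2)[OF lam c w_lim T])
    have s_lim: "(\<lambda>n. ?b n * m n - (1 - r n) * (?b n)\<^sup>2) \<longlonglongrightarrow> s"
      unfolding m_def r_def s_def \<sigma>_def by (rule cutoff_location(3)[OF lam c w_lim T])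
    have T_pos: "\<forall>\<^sub>F n in sequentially. 0 < T n"
      using T_top by (simp add: filterlim_at_top_dense)
    have Xm: "X u \<in> borel_measurable M" if "u \<ge> 0" for u
      using X that by (intro augmented_filtration_measurable[OF L that]) (simp add: OU_strong_solution_def)
    \<comment> \<open>The normalised maximum at time \<open>T n\<close> converges to the Gumbel law shifted by \<open>s\<close> \<dots>\<close>
    have Z_lim: "(\<lambda>n. tv_dist N (\<lambda>\<omega>. ?b n * (Z n (T n) \<omega> / \<sigma>) + - (?b n)\<^sup>2) P (\<lambda>\<omega>. \<xi> \<omega> + s)) \<longlonglongrightarrow> 0"
    proof (rule gauss_max_tv_tendsto_gumbel[where M = "\<lambda>_. N" and V = "\<lambda>n \<omega>. Z n (T n) \<omega> / \<sigma>",
          OF prob_N _ _ r_lim s_lim gumbel])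
      show "\<forall>\<^sub>F n in sequentially. (\<lambda>\<omega>. Z n (T n) \<omega> / \<sigma>) \<in> borel_measurable N"
        using T_pos
      proof eventually_elim
        case (elim n)
        have "(\<lambda>\<omega>. Z n (T n) \<omega>) \<in> borel_measurable N"
          unfolding Z using elim by (intro process_copies_max_cdf(1)[OF copies Xm]) simp_all
        then show ?case by simp
      qed
      show "\<forall>\<^sub>F n in sequentially. \<forall>x. \<P>(\<omega> in N. Z n (T n) \<omega> / \<sigma> \<le> x) = \<Phi> ((x - m n) / r n) ^ n"
        using T_pos eventually_gt_at_top[of 0]
      proof eventually_elim
        case (elim n)
        show ?case
        proof
          fix x
          have "\<P>(\<omega> in N. Z n (T n) \<omega> / \<sigma> \<le> x) = \<P>(\<omega> in N. Z n (T n) \<omega> \<le> x * \<sigma>)"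
            using \<sigma> by (simp only: pos_divide_le_eq)
          also have "\<dots> = cdf (distr M borel (X (T n))) (x * \<sigma>) ^ n"
            unfolding Z using elim by (intro process_copies_max_cdf(2)[OF copies Xm]) simp_all
          also have "cdf (distr M borel (X (T n))) (x * \<sigma>) = \<Phi> ((x * \<sigma> - exp (- lam * T n) * x0) / (\<sigma> * r n))"
            unfolding \<sigma>_def r_def by (rule OU_cdf[OF L X lam c elim(1) L1])
          also have "(x * \<sigma> - exp (- lam * T n) * x0) / (\<sigma> * r n) = (x - m n) / r n"
          proof -
            have "x * \<sigma> - exp (- lam * T n) * x0 = \<sigma> * (x - m n)"
              using \<sigma> by (simp add: m_def right_diff_distrib)
            then show ?thesis using \<sigma> by simp
          qed
          finally show "\<P>(\<omega> in N. Z n (T n) \<omega> / \<sigma> \<le> x) = \<Phi> ((x - m n) / r n) ^ n" .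
        qed
      qed
    qed
    \<comment> \<open>\<dots> and the normalised maximum of the limit variables to the Gumbel law itself.\<close>
    have id_borel: "(\<lambda>x::real. x) \<in> borel_measurable borel" by simp
    have Zinf_m: "(\<lambda>\<omega>. Zinf n \<omega> / \<sigma>) \<in> borel_measurable N'" for n
      using iid_max_measurable[OF iid_inf id_borel, of n] by (simp add: Zinf[abs_def])
    have "(\<lambda>n. tv_dist N' (\<lambda>\<omega>. ?b n * (Zinf n \<omega> / \<sigma>) + - (?b n)\<^sup>2) P (\<lambda>\<omega>. \<xi> \<omega> + 0)) \<longlonglongrightarrow> 0"
    proof (rule gauss_max_tv_tendsto_gumbel[where M = "\<lambda>_. N'" and V = "\<lambda>n \<omega>. Zinf n \<omega> / \<sigma>"
          and m = "\<lambda>_. 0" and r = "\<lambda>_. 1", OF prob_N' _ _ _ _ gumbel])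
      show "\<forall>\<^sub>F n in sequentially. \<forall>x. \<P>(\<omega> in N'. Zinf n \<omega> / \<sigma> \<le> x) = \<Phi> ((x - 0) / 1) ^ n"
        using eventually_gt_at_top[of 0]
      proof eventually_elim
        case (elim n)
        show ?case
        proof
          fix x
          have "\<P>(\<omega> in N'. Zinf n \<omega> / \<sigma> \<le> x) = \<P>(\<omega> in N'. Zinf n \<omega> \<le> x * \<sigma>)"
            using \<sigma> by (simp only: pos_divide_le_eq)
          also have "\<dots> = cdf (distr (distr M borel (\<lambda>\<omega>. (1 / (lam * 2)) powr (1 / 2) * L 1 \<omega>)) borel (\<lambda>x. x)) (x * \<sigma>) ^ n"
            unfolding Zinf by (rule iid_max_cdf[OF iid_inf id_borel elim])
          also have "distr (distr M borel (\<lambda>\<omega>. (1 / (lam * 2)) powr (1 / 2) * L 1 \<omega>)) borel (\<lambda>x. x)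
              = distr M borel (\<lambda>\<omega>. (1 / (lam * 2)) powr (1 / 2) * L 1 \<omega>)"
            by (rule distr_id2) simp
          also have "cdf \<dots> (x * \<sigma>) = \<Phi> (x * \<sigma> / sqrt (c / lam))"
            by (rule OU_limit_cdf[OF prob_M Lm lam c L1]) simp
          also have "x * \<sigma> / sqrt (c / lam) = (x - 0) / 1"
            using \<sigma> unfolding \<sigma>_def[symmetric] by simp
          finally show "\<P>(\<omega> in N'. Zinf n \<omega> / \<sigma> \<le> x) = \<Phi> ((x - 0) / 1) ^ n" .
        qed
      qed
    qed (simp_all add: Zinf_m)
    then have Zinf_lim: "(\<lambda>n. tv_dist N' (\<lambda>\<omega>. ?b n * (Zinf n \<omega> / \<sigma>) + - (?b n)\<^sup>2) P \<xi>) \<longlonglongrightarrow> 0"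
      by simp
    have lim: "(\<lambda>n. tv_dist N (\<lambda>\<omega>. ?b n * (Z n (T n) \<omega> / \<sigma>) + - (?b n)\<^sup>2) N' (\<lambda>\<omega>. ?b n * (Zinf n \<omega> / \<sigma>) + - (?b n)\<^sup>2))
        \<longlonglongrightarrow> tv_dist P (\<lambda>\<omega>. \<xi> \<omega> + s) P \<xi>"
      by (rule tendsto_tv_dist[OF prob_N prob_N' prob_P prob_P Z_lim Zinf_lim])
    have profile: "tv_dist P (\<lambda>\<omega>. \<xi> \<omega> + s) P \<xi> = G b"
      unfolding G s_def by (simp only: add.commute)
    \<comment> \<open>Both sides were normalised by the same affine map, which total variation does not see.\<close>
    have "\<forall>\<^sub>F n in sequentially.
        tv_dist N (\<lambda>\<omega>. ?b n * (Z n (T n) \<omega> / \<sigma>) + - (?b n)\<^sup>2) N' (\<lambda>\<omega>. ?b n * (Zinf n \<omega> / \<sigma>) + - (?b n)\<^sup>2)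
        = tv_dist N (Z n (T n)) N' (Zinf n)"
    proof -
      have "\<forall>\<^sub>F n in sequentially. 0 < ?b n"
        using gauss_max_center_at_top by (simp add: filterlim_at_top_dense)
      then show ?thesis
      proof eventually_elim
        case (elim n)
        then show ?case
          using tv_dist_affine[OF prob_N prob_N', of "?b n / \<sigma>" "Z n (T n)" "- (?b n)\<^sup>2" "Zinf n"] \<sigma> by simp
      qed
    qed
    from Lim_transform_eventually[OF lim this] show ?thesis
      unfolding profile T_def .
  qed
  have "(\<lambda>n. w n / t n) \<longlonglongrightarrow> 0"
    by (rule tendsto_divide_0[OF w_lim filterlim_at_top_imp_at_infinity[OF t_top]])
  moreover have "\<forall>b. G b \<in> {0..1}"
    using tv_dist_nonneg[OF prob_P prob_P] tv_dist_le_1[OF prob_P prob_P] by (simp add: G)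
  moreover have "(G \<longlongrightarrow> 1) at_bot"
    unfolding G[abs_def] by (rule profile_at_bot[OF gumbel lam \<open>\<kappa> > 0\<close>])
  moreover have "(G \<longlongrightarrow> 0) at_top"
    unfolding G[abs_def] by (rule profile_at_top[OF gumbel lam \<open>\<kappa> > 0\<close>])
  ultimately show ?thesis
    using t_top cutoff unfolding profile_cutoff_def by simp
qed

end
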